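(* Let $S=\langle a_1,\dots,a_k\rangle\subset\mathbb{Z}_{\ge0}$ be a numerical monoid with $a_i\ne0$ for all $i$, and let $\mathcal{O}$ be the set of Apéry orderings with respect to $a_k$ on $\mathbb{Q}[x,y_1,\dots,y_k]$. Then $$\bigcap_{\prec\in\mathcal{O}}\partial_\prec(S,a_k)=T(S).$$
   Context: A numerical monoid is a set $S=\langle a_1,\dots,a_k\rangle=\{\lambda_1a_1+\dots+\lambda_ka_k\mid \lambda_i\in\mathbb{Z}_{\ge 0}\}$ with $a_i\in\mathbb{Z}_{\geq 0}$ and $\gcd(a_1,\dots,a_k)=1$. Apéry set: for $s\in S$, $s\neq 0$, $Ap(S,s)=\{0,w_1,\dots,w_{s-1}\}$, where $w_i$ is the smallest element of $S$ congruent to $i$ modulo $s$; equivalently $Ap(S,s)=\{x\in S\mid x-s\notin S\}$. Type set: $T(S)=\{m\in Ap(S,a_k)\mid m+a_i\notin Ap(S,a_k)\ \text{for all}\ i=1,\dots,k\}$. Ideal: $I_S=\langle y_1-x^{a_1},\dots,y_k-x^{a_k}\rangle\subset\mathbb{Q}[x,y_1,\dots,y_k]$. Exponents: for a monomial ordering $\prec$ and a nonzero polynomial $g=\sum a_{\underline\alpha}x^{\alpha_0}y_1^{\alpha_1}\cdots y_k^{\alpha_k}$, $\exp(g)=\max_\prec\{\underline\alpha\mid a_{\underline\alpha}\ne 0\}\in\mathbb{Z}_{\ge 0}^{k+1}$. Apéry ordering with respect to $a_k$: a monomial ordering on $\mathbb{Q}[x,y_1,\dots,y_k]$ which compares two monomials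 $x^{\alpha_0}y_1^{\alpha_1}\cdots y_k^{\alpha_k}$ by the following criteria, in succession (each used only to break ties in the previous ones; larger value means larger monomial): (1) the exponent $\alpha_0$ of $x$; (2) the weight $\sum_{i\ne k}\alpha_ia_i$; (3) an arbitrary (chosen) monomial ordering on the variables $y_1,\dots,y_{k-1}$; (4) the exponent $\alpha_k$ of $y_k$. Given an Apéry ordering $\prec$ with respect to $a_k$, let $\mathcal{B}=\{g_1,\dots,g_r\}$ be the reduced Groebner basis of $I_S$ with respect to $\prec$, let $N_k$ denote the normal form with respect to $\mathcal{B}$ (the normal form of a monomial is again a monomial), and put $E(I_S)=\bigcup_{i=1}^r\left(\exp(g_i)+\mathbb{Z}_{\ge 0}^{k+1}\right)$, $\overline{E(I_S)}=\mathbb{Z}_{\ge 0}^{k+1}\setminus E(I_S)$. Coordinates on $\mathbb{Z}_{\geq 0}^{k+1}$ are named after the variables. For $N\in Ap(S,a_k)$ one has $\exp(N_k(x^N))=(0,\gamma_1,\dots,\gamma_{k-1},0)$ for some $\gamma_i\in\mathbb{Z}_{\ge0}$. Such an $N$ is called an extremal element of $Ap(S,a_k)$ for $\prec$ if, for all $i=1,\dots,k$, the tuple obtained from $(0,\gamma_1,\dots,\gamma_{k-1},0)$ by adding $1$ to the $y_i$-coordinate does not belong to $\overline{E(I_S)}\cap\{x=y_k=0\}$ (for $i=k$ this is automatic). The set of extremal elements of $Ap(S,a_k)$ for $\prec$ is denoted $\partial_\prec(S,a_k)$. *)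

theory Defs
  imports Complex_Main "HOL-Library.Poly_Mapping"
begin

section \<open>Numerical monoids\<close>

text \<open>The generators \<open>a\<^sub>1, \<dots>, a\<^sub>k\<close> are the values of \<open>a :: nat \<Rightarrow> nat\<close> on \<open>{1..k}\<close>;
  the other values of \<open>a\<close> are never used.\<close>

definition gen_monoid :: "nat \<Rightarrow> (nat \<Rightarrow> nat) \<Rightarrow> nat set" where
  "gen_monoid k a = {\<Sum>i=1..k. c i * a i | c :: nat \<Rightarrow> nat. True}"

definition numerical_generators :: "nat \<Rightarrow> (nat \<Rightarrow> nat) \<Rightarrow> bool" where
  "numerical_generators k a \<longleftrightarrow> Gcd (a ` {1..k}) = 1"

definition apery_set :: "nat set \<Rightarrow> nat \<Rightarrow> nat set" where
  "apery_set S s = insert 0 ((\<lambda>i. LEAST w. w \<in> S \<and> w mod s = i) ` {1..<s})"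

definition type_set :: "nat \<Rightarrow> (nat \<Rightarrow> nat) \<Rightarrow> nat set" where
  "type_set k a =
    {m \<in> apery_set (gen_monoid k a) (a k).
      \<forall>i\<in>{1..k}. m + a i \<notin> apery_set (gen_monoid k a) (a k)}"


section \<open>Monomials, polynomials and monomial orderings\<close>

text \<open>Variables are natural numbers: \<open>0\<close> stands for \<open>x\<close> and \<open>i \<in> {1..k}\<close> for \<open>y\<^sub>i\<close>. A monomial is
  identified with its exponent vector, so multiplication of monomials is addition of vectors.
  The ring of polynomials in the variables of \<open>V\<close> is a subset of one fixed type.\<close>

type_synonym mon = "nat \<Rightarrow>\<^sub>0 nat"
type_synonym qpoly = "mon \<Rightarrow>\<^sub>0 rat"

definition mons :: "nat set \<Rightarrow> mon set" where
  "mons V = {\<alpha>. Poly_Mapping.keys \<alpha> \<subseteq> V}"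

definition polys :: "nat set \<Rightarrow> qpoly set" where
  "polys V = {p. Poly_Mapping.keys p \<subseteq> mons V}"

definition unit_mon :: "nat \<Rightarrow> mon" where
  "unit_mon i = Poly_Mapping.single i 1"

definition var :: "nat \<Rightarrow> qpoly" where
  "var i = Poly_Mapping.single (unit_mon i) 1"

text \<open>\<open>(\<alpha>, \<beta>) \<in> r\<close> means \<open>\<alpha> \<preceq> \<beta>\<close>; \<open>well_order_on\<close> confines \<open>r\<close> to the monomials in \<open>V\<close>, so that
  an ordering is determined by its comparison of these monomials.\<close>

definition monomial_ordering :: "nat set \<Rightarrow> mon rel \<Rightarrow> bool" where
  "monomial_ordering V r \<longleftrightarrow>
    well_order_on (mons V) r \<and>
    (\<forall>\<alpha>\<in>mons V. \<forall>\<beta>\<in>mons V. \<forall>\<gamma>\<in>mons V. (\<alpha>, \<beta>) \<in> r \<longrightarrow> (\<alpha> + \<gamma>, \<beta> + \<gamma>) \<in> r)"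

text \<open>The part of an exponent vector in the variables \<open>y\<^sub>1, \<dots>, y\<^sub>k\<^sub>-\<^sub>1\<close>, and its weight.\<close>

definition y_part :: "nat \<Rightarrow> mon \<Rightarrow> mon" where
  "y_part k \<alpha> = (\<Sum>i\<in>{1..<k}. Poly_Mapping.single i (Poly_Mapping.lookup \<alpha> i))"

definition y_weight :: "nat \<Rightarrow> (nat \<Rightarrow> nat) \<Rightarrow> mon \<Rightarrow> nat" where
  "y_weight k a \<alpha> = (\<Sum>i\<in>{1..<k}. Poly_Mapping.lookup \<alpha> i * a i)"

definition apery_ordering :: "nat \<Rightarrow> (nat \<Rightarrow> nat) \<Rightarrow> mon rel \<Rightarrow> bool" where
  "apery_ordering k a r \<longleftrightarrow>
    monomial_ordering {0..k} r \<and>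
    (\<exists>q. monomial_ordering {1..<k} q \<and>
      (\<forall>\<alpha>\<in>mons {0..k}. \<forall>\<beta>\<in>mons {0..k}.
        (\<alpha>, \<beta>) \<in> r - Id \<longleftrightarrow>
        ((Poly_Mapping.lookup \<alpha> 0, y_weight k a \<alpha>, y_part k \<alpha>, Poly_Mapping.lookup \<alpha> k),
         (Poly_Mapping.lookup \<beta> 0, y_weight k a \<beta>, y_part k \<beta>, Poly_Mapping.lookup \<beta> k))
          \<in> less_than <*lex*> less_than <*lex*> (q - Id) <*lex*> less_than))"


section \<open>Reduced Groebner bases and normal forms\<close>

text \<open>\<open>lead_exp r g\<close> is only meaningful for \<open>g \<noteq> 0\<close>.\<close>

definition lead_exp :: "mon rel \<Rightarrow> qpoly \<Rightarrow> mon" where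
  "lead_exp r g =
    (THE \<alpha>. \<alpha> \<in> Poly_Mapping.keys g \<and> (\<forall>\<beta>\<in>Poly_Mapping.keys g. (\<beta>, \<alpha>) \<in> r))"

definition cone :: "nat set \<Rightarrow> mon \<Rightarrow> mon set" where
  "cone V \<alpha> = (+) \<alpha> ` mons V"

definition is_reduced_groebner_basis ::
    "nat set \<Rightarrow> mon rel \<Rightarrow> qpoly set \<Rightarrow> qpoly set \<Rightarrow> bool" where
  "is_reduced_groebner_basis V r I G \<longleftrightarrow>
    finite G \<and> G \<subseteq> I - {0} \<and>
    lead_exp r ` (I - {0}) = (\<Union>g\<in>G. cone V (lead_exp r g)) \<and>
    (\<forall>g\<in>G. Poly_Mapping.lookup g (lead_exp r g) = 1) \<and>
    (\<forall>g\<in>G. \<forall>h\<in>G - {g}. Poly_Mapping.keys g \<inter> cone V (lead_exp r h) = {})"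

definition reduced_groebner_basis :: "nat set \<Rightarrow> mon rel \<Rightarrow> qpoly set \<Rightarrow> qpoly set" where
  "reduced_groebner_basis V r I = (THE G. is_reduced_groebner_basis V r I G)"

text \<open>One step of the division of \<open>f\<close> by \<open>G\<close>: the term of \<open>f\<close> with exponent
  \<open>\<delta> + lead_exp r g\<close> is cancelled by a multiple of \<open>g\<close>.\<close>

definition reduces :: "nat set \<Rightarrow> mon rel \<Rightarrow> qpoly set \<Rightarrow> qpoly \<Rightarrow> qpoly \<Rightarrow> bool" where
  "reduces V r G f h \<longleftrightarrow>
    (\<exists>g\<in>G. \<exists>\<delta>\<in>mons V.
      \<delta> + lead_exp r g \<in> Poly_Mapping.keys f \<and>
      h = f - Poly_Mapping.single \<delta>
                (Poly_Mapping.lookup f (\<delta> + lead_exp r g) / Poly_Mapping.lookup g (lead_exp r g)) * g)"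

definition normal_form :: "nat set \<Rightarrow> mon rel \<Rightarrow> qpoly set \<Rightarrow> qpoly \<Rightarrow> qpoly" where
  "normal_form V r G f = (THE h. (reduces V r G)\<^sup>*\<^sup>* f h \<and> (\<nexists>h'. reduces V r G h h'))"


section \<open>The ideal of a numerical monoid and extremal elements\<close>

definition monoid_ideal :: "nat \<Rightarrow> (nat \<Rightarrow> nat) \<Rightarrow> qpoly set" where
  "monoid_ideal k a =
    {\<Sum>i=1..k. c i * (var i - var 0 ^ a i) | c. \<forall>i\<in>{1..k}. c i \<in> polys {0..k}}"

definition monoid_basis :: "nat \<Rightarrow> (nat \<Rightarrow> nat) \<Rightarrow> mon rel \<Rightarrow> qpoly set" where
  "monoid_basis k a r = reduced_groebner_basis {0..k} r (monoid_ideal k a)"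

definition E_set :: "nat \<Rightarrow> (nat \<Rightarrow> nat) \<Rightarrow> mon rel \<Rightarrow> mon set" where
  "E_set k a r = (\<Union>g\<in>monoid_basis k a r. cone {0..k} (lead_exp r g))"

definition E_compl :: "nat \<Rightarrow> (nat \<Rightarrow> nat) \<Rightarrow> mon rel \<Rightarrow> mon set" where
  "E_compl k a r = mons {0..k} - E_set k a r"

definition extremal_elements :: "nat \<Rightarrow> (nat \<Rightarrow> nat) \<Rightarrow> mon rel \<Rightarrow> nat set" where
  "extremal_elements k a r =
    {N \<in> apery_set (gen_monoid k a) (a k).
      \<forall>i\<in>{1..k}.
        lead_exp r (normal_form {0..k} r (monoid_basis k a r) (var 0 ^ N)) + unit_mon i
          \<notin> E_compl k a r \<inter> {\<alpha>. Poly_Mapping.lookup \<alpha> 0 = 0 \<and> Poly_Mapping.lookup \<alpha> k = 0}}"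

end

theory Submission
  imports Defs
begin

text \<open>Every fibre of the weighted degree \<open>D\<close>, in which \<open>x\<close> has weight \<open>1\<close> and \<open>y\<^sub>i\<close> has weight \<open>a i\<close>,
  has a least monomial, its standard monomial. Since \<open>I\<^sub>S\<close> is spanned by the differences of monomials
  of equal degree, \<open>E(I\<^sub>S)\<close> consists of the nonstandard monomials, and the normal form of \<open>x\<^sup>N\<close> is
  the standard monomial \<open>\<mu>(N)\<close> of degree \<open>N\<close>. So \<open>N\<close> is extremal iff \<open>\<mu>(N) y\<^sub>i\<close> is nonstandard for all
  \<open>i < k\<close>. If \<open>N + a i\<close> is not in the Apery set, then it has a representation that uses \<open>y\<^sub>k\<close>; its
  weight without \<open>y\<^sub>k\<close> is smaller than that of \<open>\<mu>(N) y\<^sub>i\<close>, which is therefore nonstandard. If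
  \<open>N + a i\<close> is in the Apery set, choose an ordering in which, at equal weight, more factors \<open>y\<^sub>i\<close> make
  a monomial smaller: then \<open>y\<^sub>i\<close> divides \<open>\<mu>(N + a i)\<close>, hence \<open>\<mu>(N + a i) = \<mu>(N) y\<^sub>i\<close>.\<close>

section \<open>Monomials\<close>

abbreviation lookup :: "('a \<Rightarrow>\<^sub>0 'b::zero) \<Rightarrow> 'a \<Rightarrow> 'b" where
  "lookup \<equiv> Poly_Mapping.lookup"

abbreviation keys :: "('a \<Rightarrow>\<^sub>0 'b::zero) \<Rightarrow> 'a set" where
  "keys \<equiv> Poly_Mapping.keys"

abbreviation monom :: "mon \<Rightarrow> rat \<Rightarrow> qpoly" where
  "monom \<equiv> Poly_Mapping.single"

lemma zero_in_mons [simp]: "0 \<in> mons V"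
  by (simp add: mons_def)

lemma add_in_mons [simp]: "\<alpha> \<in> mons V \<Longrightarrow> \<beta> \<in> mons V \<Longrightarrow> \<alpha> + \<beta> \<in> mons V"
  unfolding mons_def using keys_add[of \<alpha> \<beta>] by blast

lemma add_in_mons_iff: "\<alpha> + \<beta> \<in> mons V \<longleftrightarrow> \<alpha> \<in> mons V \<and> \<beta> \<in> mons V"
  by (auto simp: mons_def in_keys_iff lookup_add subset_eq)

lemma lookup_outside: "\<alpha> \<in> mons V \<Longrightarrow> i \<notin> V \<Longrightarrow> lookup \<alpha> i = 0"
  by (auto simp: mons_def in_keys_iff subset_eq)

lemma single_in_mons [simp]: "i \<in> V \<Longrightarrow> Poly_Mapping.single i n \<in> mons V"
  by (simp add: mons_def)

lemma unit_in_mons [simp]: "i \<in> V \<Longrightarrow> unit_mon i \<in> mons V"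
  by (simp add: unit_mon_def)

lemma lookup_unit: "lookup (unit_mon i) j = (if i = j then 1 else 0)"
  by (simp add: unit_mon_def lookup_single when_def)

lemma cone_self [simp]: "\<alpha> \<in> cone V \<alpha>"
  unfolding cone_def by (rule image_eqI[of _ _ 0]) auto

lemma cone_trans: "\<gamma> \<in> cone V \<beta> \<Longrightarrow> \<beta> \<in> cone V \<alpha> \<Longrightarrow> \<gamma> \<in> cone V \<alpha>"
  by (auto simp: cone_def add.assoc)

text \<open>Cones encode divisibility: the componentwise difference is the cofactor, and the
  hypothesis keeps its truncated subtraction exact.\<close>

lemma le_imp_in_cone:
  assumes "\<beta> \<in> mons V" "\<And>i. lookup \<alpha> i \<le> lookup \<beta> i"
  shows "\<beta> \<in> cone V \<alpha>"
proof -
  have "\<beta> = \<alpha> + (\<beta> - \<alpha>)"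
    using assms(2) by (intro poly_mapping_eqI) (simp add: lookup_add lookup_minus)
  moreover from this have "\<beta> - \<alpha> \<in> mons V"
    using assms(1) by (metis add_in_mons_iff)
  ultimately show ?thesis by (auto simp: cone_def)
qed

lemma split_unit:
  assumes "lookup \<alpha> i \<noteq> 0" "\<alpha> \<in> mons V"
  obtains \<delta> where "\<delta> \<in> mons V" "\<alpha> = \<delta> + unit_mon i"
proof -
  have "\<alpha> \<in> cone V (unit_mon i)"
    using assms by (intro le_imp_in_cone) (auto simp: lookup_unit)
  then show thesis using that by (auto simp: cone_def add.commute)
qed

text \<open>Exponents outside \<open>V\<close> vanish, so these monomials are functions from a
  finite set into \<open>{..n}\<close>, extended by zero.\<close>

lemma finite_bounded_mons:
  assumes "finite V"
  shows "finite {\<alpha> \<in> mons V. \<forall>i\<in>V. lookup \<alpha> i \<le> n}"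
proof (rule finite_imageD)
  have "lookup ` {\<alpha> \<in> mons V. \<forall>i\<in>V. lookup \<alpha> i \<le> n}
      \<subseteq> {f. \<forall>x. (x \<in> V \<longrightarrow> f x \<in> {..n}) \<and> (x \<notin> V \<longrightarrow> f x = 0)}"
    by (auto simp: lookup_outside)
  then show "finite (lookup ` {\<alpha> \<in> mons V. \<forall>i\<in>V. lookup \<alpha> i \<le> n})"
    by (rule finite_subset) (rule finite_set_of_finite_funs[OF assms finite_atMost])
  show "inj_on lookup {\<alpha> \<in> mons V. \<forall>i\<in>V. lookup \<alpha> i \<le> n}"
    by (rule inj_onI) (simp add: lookup_inject)
qed

lemma var_power: "var i ^ n = monom (Poly_Mapping.single i n) 1"
  by (induction n)
    (simp_all add: var_def unit_mon_def mult_single flip: single_add)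

section \<open>The weighted degree and the parts compared by an Apery ordering\<close>

definition mon_degree :: "nat \<Rightarrow> (nat \<Rightarrow> nat) \<Rightarrow> mon \<Rightarrow> nat" where
  "mon_degree k a \<alpha> = lookup \<alpha> 0 + (\<Sum>i=1..k. lookup \<alpha> i * a i)"

lemma mon_degree_add: "mon_degree k a (\<alpha> + \<beta>) = mon_degree k a \<alpha> + mon_degree k a \<beta>"
  by (simp add: mon_degree_def lookup_add sum.distrib algebra_simps)

lemma mon_degree_single_0 [simp]: "mon_degree k a (Poly_Mapping.single 0 n) = n"
  by (simp add: mon_degree_def lookup_single when_def)

lemma mon_degree_single: "i \<in> {1..k} \<Longrightarrow> mon_degree k a (Poly_Mapping.single i n) = n * a i"
  by (simp add: mon_degree_def lookup_single when_def if_distrib[of "\<lambda>x. x * _"] cong: if_cong)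

lemma mon_degree_unit: "i \<in> {1..k} \<Longrightarrow> mon_degree k a (unit_mon i) = a i"
  by (simp add: unit_mon_def mon_degree_single)

lemma mon_degree_zero [simp]: "mon_degree k a 0 = 0"
  by (simp add: mon_degree_def)

lemma mon_degree_eq_0:
  assumes "\<alpha> \<in> mons {0..k}" "\<forall>i\<in>{1..k}. a i \<noteq> 0" "mon_degree k a \<alpha> = 0"
  shows "\<alpha> = 0"
proof (rule poly_mapping_eqI)
  fix i
  show "lookup \<alpha> i = lookup 0 i"
  proof (cases "i \<in> {1..k}")
    case True
    then show ?thesis using assms(2,3) by (force simp: mon_degree_def)
  next
    case False
    then show ?thesis using assms(1,3)
      by (cases "i = 0") (auto simp: mon_degree_def intro: lookup_outside)
  qed
qed

text \<open>Links the grading to criterion (2): among monomials of equal degree and equal exponent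
  of x, more factors y_k means smaller weight.\<close>

lemma mon_degree_y_weight:
  "k \<ge> 1 \<Longrightarrow> mon_degree k a \<alpha> = lookup \<alpha> 0 + y_weight k a \<alpha> + lookup \<alpha> k * a k"
  by (cases k) (simp_all add: mon_degree_def y_weight_def atLeastLessThanSuc_atLeastAtMost)

lemma lookup_y_part: "lookup (y_part k \<alpha>) i = (if i \<in> {1..<k} then lookup \<alpha> i else 0)"
  by (simp add: y_part_def lookup_sum lookup_single when_def)

lemma y_weight_add: "y_weight k a (\<alpha> + \<beta>) = y_weight k a \<alpha> + y_weight k a \<beta>"
  by (simp add: y_weight_def lookup_add sum.distrib algebra_simps)

lemma y_part_add: "y_part k (\<alpha> + \<beta>) = y_part k \<alpha> + y_part k \<beta>"
  by (rule poly_mapping_eqI) (simp add: lookup_add lookup_y_part)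

lemma y_part_in_mons [simp]: "y_part k \<alpha> \<in> mons {1..<k}"
  by (auto simp: mons_def in_keys_iff lookup_y_part split: if_splits)

section \<open>The ideal of a numerical monoid\<close>

lemma keys_minus_subset: "keys (p - q :: 'a \<Rightarrow>\<^sub>0 'b::ab_group_add) \<subseteq> keys p \<union> keys q"
  by (auto simp: in_keys_iff lookup_minus)

lemma diff_in_polys: "p \<in> polys V \<Longrightarrow> q \<in> polys V \<Longrightarrow> p - q \<in> polys V"
  unfolding polys_def using keys_minus_subset[of p q] by blast

lemma add_in_polys: "p \<in> polys V \<Longrightarrow> q \<in> polys V \<Longrightarrow> p + q \<in> polys V"
  unfolding polys_def using keys_add[of p q] by blast

lemma mult_in_polys:
  assumes "p \<in> polys V" "q \<in> polys V"
  shows "p * q \<in> polys V"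
proof -
  have "\<gamma> \<in> mons V" if "\<gamma> \<in> keys (p * q)" for \<gamma>
    using keys_mult[of p q] that assms by (force simp: polys_def)
  then show ?thesis by (auto simp: polys_def)
qed

lemma monom_in_polys [simp]: "\<alpha> \<in> mons V \<Longrightarrow> monom \<alpha> c \<in> polys V"
  by (simp add: polys_def)

lemma monoid_ideal_diff:
  assumes "p \<in> monoid_ideal k a" "q \<in> monoid_ideal k a"
  shows "p - q \<in> monoid_ideal k a"
proof -
  obtain c d where "p = (\<Sum>i=1..k. c i * (var i - var 0 ^ a i))" "\<forall>i\<in>{1..k}. c i \<in> polys {0..k}"
    "q = (\<Sum>i=1..k. d i * (var i - var 0 ^ a i))" "\<forall>i\<in>{1..k}. d i \<in> polys {0..k}"
    using assms by (auto simp: monoid_ideal_def)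
  then have "p - q = (\<Sum>i=1..k. (c i - d i) * (var i - var 0 ^ a i))"
      "\<forall>i\<in>{1..k}. c i - d i \<in> polys {0..k}"
    by (auto simp: left_diff_distrib sum_subtractf diff_in_polys)
  then show ?thesis
    unfolding monoid_ideal_def mem_Collect_eq by (intro exI[of _ "\<lambda>i. c i - d i"]) simp
qed

lemma monoid_ideal_mult:
  assumes "p \<in> monoid_ideal k a" "q \<in> polys {0..k}"
  shows "q * p \<in> monoid_ideal k a"
proof -
  obtain c where "p = (\<Sum>i=1..k. c i * (var i - var 0 ^ a i))" "\<forall>i\<in>{1..k}. c i \<in> polys {0..k}"
    using assms by (auto simp: monoid_ideal_def)
  then have "q * p = (\<Sum>i=1..k. (q * c i) * (var i - var 0 ^ a i))"
      "\<forall>i\<in>{1..k}. q * c i \<in> polys {0..k}"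
    using assms(2) by (auto simp: sum_distrib_left mult.assoc mult_in_polys)
  then show ?thesis
    unfolding monoid_ideal_def mem_Collect_eq by (intro exI[of _ "\<lambda>i. q * c i"]) simp
qed

lemma monoid_ideal_zero: "0 \<in> monoid_ideal k a"
  unfolding monoid_ideal_def mem_Collect_eq by (intro exI[of _ "\<lambda>_. 0"]) (simp add: polys_def)

lemma monoid_ideal_add:
  assumes "p \<in> monoid_ideal k a" "q \<in> monoid_ideal k a"
  shows "p + q \<in> monoid_ideal k a"
  using monoid_ideal_diff[OF assms(1) monoid_ideal_diff[OF monoid_ideal_zero assms(2)]] by simp

lemma monoid_ideal_generator:
  assumes "i \<in> {1..k}"
  shows "var i - var 0 ^ a i \<in> monoid_ideal k a"
proof -
  have "(1::qpoly) \<in> polys {0..k}" by (simp add: polys_def)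
  moreover have "var i - var 0 ^ a i
      = (\<Sum>j=1..k. (if j = i then 1 else 0) * (var j - var 0 ^ a j))"
    using assms by (simp add: if_distrib[of "\<lambda>x. x * _"] cong: if_cong)
  ultimately show ?thesis
    unfolding monoid_ideal_def mem_Collect_eq
    by (intro exI[of _ "\<lambda>j. if j = i then 1 else 0"]) (simp add: polys_def)
qed

lemma monoid_ideal_polys: "monoid_ideal k a \<subseteq> polys {0..k}"
proof -
  have "(\<Sum>i\<in>A. c i * (var i - var 0 ^ a i)) \<in> polys {0..k}"
    if "finite A" "A \<subseteq> {1..k}" "\<forall>i\<in>A. c i \<in> polys {0..k}" for A c
    using that
  proof (induction A rule: finite_induct)
    case empty
    show ?case by (simp add: polys_def)
  next
    case (insert i A)
    have "var i - var 0 ^ a i \<in> polys {0..k}"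
      unfolding var_power var_def[of i] using insert.prems by (intro diff_in_polys monom_in_polys) auto
    then show ?case using insert by (auto intro!: add_in_polys mult_in_polys)
  qed
  from this[of "{1..k}"] show ?thesis by (auto simp: monoid_ideal_def)
qed

text \<open>Modulo the ideal each y_i may be traded for x^(a_i), which preserves the degree; the
  induction is on the total exponent of the y_i.\<close>

lemma monom_minus_x_power:
  assumes "\<alpha> \<in> mons {0..k}"
  shows "monom \<alpha> 1 - monom (Poly_Mapping.single 0 (mon_degree k a \<alpha>)) 1 \<in> monoid_ideal k a"
  using assms
proof (induction "\<Sum>i=1..k. lookup \<alpha> i" arbitrary: \<alpha> rule: less_induct)
  case less
  show ?case
  proof (cases "\<exists>i\<in>{1..k}. lookup \<alpha> i \<noteq> 0")
    case True
    then obtain i where i: "i \<in> {1..k}" "lookup \<alpha> i \<noteq> 0" by blast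
    then obtain \<delta> where d: "\<delta> \<in> mons {0..k}" "\<alpha> = \<delta> + unit_mon i"
      using split_unit less.prems by metis
    \<comment> \<open>One factor y_i of \<open>\<alpha>\<close> is replaced by x^(a_i); the
      difference of the two monomials is \<open>monom \<delta> 1\<close> times the i-th
      generator.\<close>
    define \<beta> where "\<beta> = \<delta> + Poly_Mapping.single 0 (a i)"
    have "(\<Sum>j=1..k. lookup \<beta> j) = (\<Sum>j=1..k. lookup \<delta> j)"
      by (intro sum.cong) (auto simp: \<beta>_def lookup_add lookup_single)
    also have "\<dots> < (\<Sum>j=1..k. lookup \<alpha> j)"
      using i by (intro sum_strict_mono_ex1) (auto simp: d lookup_add lookup_unit)
    finally have "monom \<beta> 1 - monom (Poly_Mapping.single 0 (mon_degree k a \<beta>)) 1 \<in> monoid_ideal k a"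
      using d by (intro less.hyps) (auto simp: \<beta>_def)
    moreover have "mon_degree k a \<beta> = mon_degree k a \<alpha>"
      using i by (simp add: \<beta>_def d mon_degree_add mon_degree_unit)
    moreover have "monom \<delta> 1 * (var i - var 0 ^ a i) \<in> monoid_ideal k a"
      using d i by (intro monoid_ideal_mult monoid_ideal_generator) auto
    then have "monom \<alpha> 1 - monom \<beta> 1 \<in> monoid_ideal k a"
      by (simp add: var_power var_def[of i] right_diff_distrib mult_single d \<beta>_def)
    ultimately show ?thesis
      using monoid_ideal_add by fastforce
  next
    case False
    then have "\<alpha> = Poly_Mapping.single 0 (mon_degree k a \<alpha>)"
      using lookup_outside[OF less.prems]
      by (intro poly_mapping_eqI) (auto simp: mon_degree_def lookup_single when_def)
    then show ?thesis using monoid_ideal_zero by simp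
  qed
qed

lemma monom_diff_in_monoid_ideal:
  assumes "\<alpha> \<in> mons {0..k}" "\<beta> \<in> mons {0..k}" "mon_degree k a \<alpha> = mon_degree k a \<beta>"
  shows "monom \<alpha> 1 - monom \<beta> 1 \<in> monoid_ideal k a"
  using monoid_ideal_diff[OF monom_minus_x_power[OF assms(1), of a]
      monom_minus_x_power[OF assms(2), of a]] assms(3) by simp

text \<open>The coefficient of \<open>x\<^sup>d\<close> in the image of \<open>p\<close> under \<open>y\<^sub>i \<mapsto> x\<^bsup>a i\<^esup>\<close>.\<close>

definition degree_coeff :: "nat \<Rightarrow> (nat \<Rightarrow> nat) \<Rightarrow> nat \<Rightarrow> qpoly \<Rightarrow> rat" where
  "degree_coeff k a d p = (\<Sum>\<alpha>\<in>keys p. if mon_degree k a \<alpha> = d then lookup p \<alpha> else 0)"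

text \<open>Lets polynomials with different supports be summed over one common index set, as
  additivity requires.\<close>

lemma degree_coeff_superset:
  assumes "finite A" "keys p \<subseteq> A"
  shows "degree_coeff k a d p = (\<Sum>\<alpha>\<in>A. if mon_degree k a \<alpha> = d then lookup p \<alpha> else 0)"
  unfolding degree_coeff_def using assms
  by (intro sum.mono_neutral_left) (auto simp: in_keys_iff)

lemma degree_coeff_add: "degree_coeff k a d (p + q) = degree_coeff k a d p + degree_coeff k a d q"
proof -
  define A where "A = keys p \<union> keys q"
  have "degree_coeff k a d f = (\<Sum>\<alpha>\<in>A. if mon_degree k a \<alpha> = d then lookup f \<alpha> else 0)"
    if "f \<in> {p, q, p + q}" for f
    using that keys_add[of p q] by (intro degree_coeff_superset) (auto simp: A_def)
  then show ?thesis by (simp flip: sum.distrib) (intro sum.cong, auto simp: lookup_add)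
qed

lemma degree_coeff_sum: "degree_coeff k a d (\<Sum>i\<in>A. f i) = (\<Sum>i\<in>A. degree_coeff k a d (f i))"
  by (induction A rule: infinite_finite_induct) (simp_all add: degree_coeff_add degree_coeff_def[of _ _ _ 0])

lemma degree_coeff_uminus: "degree_coeff k a d (- p) = - degree_coeff k a d p"
  using degree_coeff_add[of k a d p "-p"] by (simp add: degree_coeff_def[of _ _ _ 0])

lemma degree_coeff_monom: "degree_coeff k a d (monom \<alpha> c) = (if mon_degree k a \<alpha> = d then c else 0)"
  by (simp add: degree_coeff_def)

lemma sum_monoms: "(\<Sum>\<alpha>\<in>keys p. monom \<alpha> (lookup p \<alpha>)) = p"
  by (rule poly_mapping_eqI) (simp add: lookup_sum lookup_single when_def in_keys_iff)

text \<open>By linearity \<open>c\<close> may be taken to be a term; its product with the generator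
  consists of two terms of equal degree and opposite coefficients.\<close>

lemma degree_coeff_generator:
  assumes "i \<in> {1..k}"
  shows "degree_coeff k a d (c * (var i - var 0 ^ a i)) = 0"
proof -
  have "degree_coeff k a d (c * (var i - var 0 ^ a i))
      = degree_coeff k a d (\<Sum>\<alpha>\<in>keys c. monom \<alpha> (lookup c \<alpha>) * (var i - var 0 ^ a i))"
    by (simp add: sum_monoms flip: sum_distrib_right)
  also have "\<dots> = (\<Sum>\<alpha>\<in>keys c. degree_coeff k a d (monom (\<alpha> + unit_mon i) (lookup c \<alpha>)
      + - monom (\<alpha> + Poly_Mapping.single 0 (a i)) (lookup c \<alpha>)))"
    unfolding degree_coeff_sum
    by (intro sum.cong arg_cong[where f = "degree_coeff k a d"])
      (simp_all add: var_power var_def[of i] right_diff_distrib mult_single)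
  also have "\<dots> = 0"
    using assms
    by (simp only: degree_coeff_add degree_coeff_uminus)
      (simp add: degree_coeff_monom mon_degree_add mon_degree_unit)
  finally show ?thesis .
qed

lemma degree_coeff_monoid_ideal: "p \<in> monoid_ideal k a \<Longrightarrow> degree_coeff k a d p = 0"
  by (auto simp: monoid_ideal_def degree_coeff_sum degree_coeff_generator)

text \<open>If \<open>\<alpha>\<close> were the only monomial of its degree in \<open>p\<close>, its
  nonzero coefficient would be the whole degree coefficient, which vanishes on the ideal.\<close>

lemma monoid_ideal_key_partner:
  assumes "p \<in> monoid_ideal k a" "\<alpha> \<in> keys p"
  obtains \<beta> where "\<beta> \<in> keys p" "\<beta> \<noteq> \<alpha>" "mon_degree k a \<beta> = mon_degree k a \<alpha>"
proof (rule ccontr)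
  assume "\<not> thesis"
  then have "degree_coeff k a (mon_degree k a \<alpha>) p
      = (\<Sum>\<beta>\<in>keys p. if \<beta> = \<alpha> then lookup p \<alpha> else 0)"
    unfolding degree_coeff_def using that by (intro sum.cong) auto
  also have "\<dots> = lookup p \<alpha>" using assms(2) by simp
  finally show False
    using degree_coeff_monoid_ideal[OF assms(1)] assms(2) by (simp add: in_keys_iff)
qed

section \<open>Standard monomials and the reduced Groebner basis\<close>

text \<open>Standard monomials and normal forms are treated for arbitrary monomial orderings; the
  criteria of an Apery ordering enter later, beginning with the finiteness of
  \<open>corners\<close>.\<close>

locale graded_order =
  fixes k :: nat and a :: "nat \<Rightarrow> nat" and r :: "mon rel"
  assumes ordering: "monomial_ordering {0..k} r"
    and generators_nonzero: "\<forall>i\<in>{1..k}. a i \<noteq> 0"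
begin

abbreviation M :: "mon set" where "M \<equiv> mons {0..k}"
abbreviation D :: "mon \<Rightarrow> nat" where "D \<equiv> mon_degree k a"
abbreviation I :: "qpoly set" where "I \<equiv> monoid_ideal k a"

section \<open>Monomial orderings and leading exponents\<close>

lemma order_facts: "r \<subseteq> M \<times> M" "refl_on M r" "trans r" "antisym r" "total_on M r" "wf (r - Id)"
  using ordering by (auto simp: monomial_ordering_def well_order_on_def order_on_defs)

lemma order_refl: "\<alpha> \<in> M \<Longrightarrow> (\<alpha>, \<alpha>) \<in> r"
  using order_facts by (auto simp: refl_on_def)

lemma order_antisym: "(\<alpha>, \<beta>) \<in> r \<Longrightarrow> (\<beta>, \<alpha>) \<in> r \<Longrightarrow> \<alpha> = \<beta>"
  using order_facts by (auto simp: antisym_def)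

lemma order_trans: "(\<alpha>, \<beta>) \<in> r \<Longrightarrow> (\<beta>, \<gamma>) \<in> r \<Longrightarrow> (\<alpha>, \<gamma>) \<in> r"
  using order_facts by (meson transD)

lemma order_linear: "\<alpha> \<in> M \<Longrightarrow> \<beta> \<in> M \<Longrightarrow> (\<alpha>, \<beta>) \<in> r \<or> (\<beta>, \<alpha>) \<in> r"
  using order_facts(5) order_refl unfolding total_on_def by metis

lemma order_add:
  "(\<alpha>, \<beta>) \<in> r \<Longrightarrow> \<gamma> \<in> M \<Longrightarrow> (\<alpha> + \<gamma>, \<beta> + \<gamma>) \<in> r"
  using ordering order_facts(1) by (auto simp: monomial_ordering_def)

lemma order_least:
  assumes "A \<subseteq> M" "A \<noteq> {}"
  obtains \<mu> where "\<mu> \<in> A" "\<And>\<alpha>. \<alpha> \<in> A \<Longrightarrow> (\<mu>, \<alpha>) \<in> r"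
proof -
  obtain \<mu> where mu: "\<mu> \<in> A" "\<And>\<alpha>. (\<alpha>, \<mu>) \<in> r - Id \<Longrightarrow> \<alpha> \<notin> A"
    using order_facts(6) assms(2) by (metis wfE_min all_not_in_conv)
  then have "(\<mu>, \<alpha>) \<in> r" if "\<alpha> \<in> A" for \<alpha>
    using order_linear[of \<mu> \<alpha>] order_refl assms that by blast
  then show thesis using that mu by blast
qed

lemma order_greatest:
  assumes "finite A" "A \<subseteq> M" "A \<noteq> {}"
  shows "\<exists>\<mu>\<in>A. \<forall>\<alpha>\<in>A. (\<alpha>, \<mu>) \<in> r"
  using assms(1,3,2)
proof (induction A rule: finite_ne_induct)
  case (singleton \<alpha>)
  then show ?case using order_refl by auto
next
  case (insert \<alpha> A)
  then obtain \<mu> where "\<mu> \<in> A" "\<forall>\<beta>\<in>A. (\<beta>, \<mu>) \<in> r" by auto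
  then show ?case
    using order_linear[of \<alpha> \<mu>] order_refl[of \<alpha>] order_trans[of _ \<mu> \<alpha>] insert.prems by blast
qed

text \<open>If \<open>\<mu>\<close> is the least monomial, then \<open>\<mu> \<preceq> \<mu>\<^sup>2 \<preceq> \<mu>\<close>, since \<open>\<mu> \<preceq> 1\<close>.\<close>

lemma zero_least:
  assumes "\<gamma> \<in> M"
  shows "(0, \<gamma>) \<in> r"
proof -
  obtain \<mu> where mu: "\<mu> \<in> M" "\<And>\<alpha>. \<alpha> \<in> M \<Longrightarrow> (\<mu>, \<alpha>) \<in> r"
    using order_least[of M] zero_in_mons by blast
  have "(\<mu> + \<mu>, 0 + \<mu>) \<in> r" using mu by (intro order_add) auto
  then have "\<mu> + \<mu> = \<mu>" using order_antisym[of "\<mu> + \<mu>" \<mu>] mu by simp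
  then have "\<mu> = 0" by simp
  then show ?thesis using mu assms by blast
qed

lemma lead_exp_eqI:
  assumes "\<alpha> \<in> keys p" "\<And>\<beta>. \<beta> \<in> keys p \<Longrightarrow> (\<beta>, \<alpha>) \<in> r"
  shows "lead_exp r p = \<alpha>"
  unfolding lead_exp_def using assms order_antisym by (intro the_equality) blast+

lemma lead_exp_greatest:
  assumes "p \<in> polys {0..k}" "p \<noteq> 0"
  shows "lead_exp r p \<in> keys p" "\<And>\<beta>. \<beta> \<in> keys p \<Longrightarrow> (\<beta>, lead_exp r p) \<in> r"
proof -
  obtain \<alpha> where al: "\<alpha> \<in> keys p" "\<forall>\<beta>\<in>keys p. (\<beta>, \<alpha>) \<in> r"
    using order_greatest[of "keys p"] assms by (auto simp: polys_def)
  then have "lead_exp r p = \<alpha>" by (intro lead_exp_eqI) auto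
  then show "lead_exp r p \<in> keys p" "\<And>\<beta>. \<beta> \<in> keys p \<Longrightarrow> (\<beta>, lead_exp r p) \<in> r"
    using al by auto
qed

lemma lead_exp_monom: "\<alpha> \<in> M \<Longrightarrow> lead_exp r (monom \<alpha> 1) = \<alpha>"
  using order_refl by (intro lead_exp_eqI) auto

section \<open>Standard and nonstandard monomials\<close>

definition std :: "nat \<Rightarrow> mon" where
  "std N = (SOME \<mu>. \<mu> \<in> M \<and> D \<mu> = N \<and> (\<forall>\<alpha>\<in>M. D \<alpha> = N \<longrightarrow> (\<mu>, \<alpha>) \<in> r))"

text \<open>The fibre of degree \<open>N\<close> contains x^N, so the well-order provides a least
  element for the choice operator.\<close>

lemma std: "std N \<in> M" "D (std N) = N" "\<And>\<alpha>. \<alpha> \<in> M \<Longrightarrow> D \<alpha> = N \<Longrightarrow> (std N, \<alpha>) \<in> r"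
proof -
  have "Poly_Mapping.single 0 N \<in> {\<alpha> \<in> M. D \<alpha> = N}" by simp
  then have "{\<alpha> \<in> M. D \<alpha> = N} \<noteq> {}" by blast
  then obtain \<mu> where "\<mu> \<in> {\<alpha> \<in> M. D \<alpha> = N}" "\<And>\<alpha>. \<alpha> \<in> {\<alpha> \<in> M. D \<alpha> = N} \<Longrightarrow> (\<mu>, \<alpha>) \<in> r"
    using order_least[of "{\<alpha> \<in> M. D \<alpha> = N}"] by blast
  then have "\<exists>\<mu>. \<mu> \<in> M \<and> D \<mu> = N \<and> (\<forall>\<alpha>\<in>M. D \<alpha> = N \<longrightarrow> (\<mu>, \<alpha>) \<in> r)" by blast
  from someI_ex[OF this]
  show "std N \<in> M" "D (std N) = N" "\<And>\<alpha>. \<alpha> \<in> M \<Longrightarrow> D \<alpha> = N \<Longrightarrow> (std N, \<alpha>) \<in> r"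
    by (auto simp: std_def)
qed

definition nonstd :: "mon set" where
  "nonstd = {\<alpha> \<in> M. std (D \<alpha>) \<noteq> \<alpha>}"

lemma nonstdI:
  assumes "(\<beta>, \<alpha>) \<in> r" "\<beta> \<noteq> \<alpha>" "D \<beta> = D \<alpha>"
  shows "\<alpha> \<in> nonstd"
  using assms order_facts(1) std(3)[of \<beta> "D \<alpha>"] order_antisym[of \<alpha> \<beta>]
  by (auto simp: nonstd_def)

lemma std_notin_nonstd [simp]: "std N \<notin> nonstd"
  by (simp add: nonstd_def std)

text \<open>A smaller monomial of the same degree stays smaller and of the same degree after
  multiplication by \<open>\<gamma>\<close>, so the nonstandard monomials form a monomial
  ideal.\<close>

lemma nonstd_add:
  assumes "\<alpha> \<in> nonstd" "\<gamma> \<in> M"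
  shows "\<alpha> + \<gamma> \<in> nonstd"
proof (rule nonstdI)
  show "(std (D \<alpha>) + \<gamma>, \<alpha> + \<gamma>) \<in> r"
    using assms std(3) by (intro order_add) (auto simp: nonstd_def)
qed (use assms in \<open>auto simp: nonstd_def std mon_degree_add\<close>)

lemma cone_nonstd: "\<alpha> \<in> nonstd \<Longrightarrow> cone {0..k} \<alpha> \<subseteq> nonstd"
  by (auto simp: cone_def nonstd_add)

text \<open>The leading monomial shares its degree with another monomial of \<open>p\<close>, and
  that one is smaller.\<close>

lemma lead_exp_nonstd:
  assumes "p \<in> I" "p \<noteq> 0"
  shows "lead_exp r p \<in> nonstd"
proof -
  have p: "p \<in> polys {0..k}" using assms monoid_ideal_polys by blast
  obtain \<beta> where "\<beta> \<in> keys p" "\<beta> \<noteq> lead_exp r p" "D \<beta> = D (lead_exp r p)"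
    using monoid_ideal_key_partner assms lead_exp_greatest[OF p] by metis
  then show ?thesis using lead_exp_greatest(2)[OF p assms(2)] nonstdI by blast
qed

text \<open>Standard monomials are linearly independent modulo the ideal. This is the source of
  uniqueness for both the reduced basis and the normal form.\<close>

lemma ideal_std_eq_0:
  assumes "p \<in> I" "keys p \<inter> nonstd = {}"
  shows "p = 0"
  using lead_exp_nonstd[OF assms(1)] lead_exp_greatest[of p] assms monoid_ideal_polys by blast

section \<open>Binomials and the reduced Groebner basis\<close>

definition binom :: "mon \<Rightarrow> qpoly" where
  "binom \<alpha> = monom \<alpha> 1 - monom (std (D \<alpha>)) 1"

lemma binom_in_ideal: "\<alpha> \<in> M \<Longrightarrow> binom \<alpha> \<in> I"
  unfolding binom_def by (intro monom_diff_in_monoid_ideal) (auto simp: std)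

lemma lookup_binom:
  "lookup (binom \<alpha>) \<beta> = (if \<beta> = \<alpha> then 1 else 0) - (if \<beta> = std (D \<alpha>) then 1 else 0)"
  by (auto simp: binom_def lookup_minus lookup_single when_def)

lemma keys_binom: "\<alpha> \<in> nonstd \<Longrightarrow> keys (binom \<alpha>) = {\<alpha>, std (D \<alpha>)}"
  by (auto simp: in_keys_iff lookup_binom nonstd_def split: if_splits)

lemma binom_nonzero: "\<alpha> \<in> nonstd \<Longrightarrow> binom \<alpha> \<noteq> 0"
  using keys_binom by fastforce

lemma lead_exp_binom: "\<alpha> \<in> nonstd \<Longrightarrow> lead_exp r (binom \<alpha>) = \<alpha>"
  using order_refl std(3) by (intro lead_exp_eqI) (auto simp: keys_binom nonstd_def)

lemma lookup_binom_lead: "\<alpha> \<in> nonstd \<Longrightarrow> lookup (binom \<alpha>) \<alpha> = 1"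
  by (auto simp: lookup_binom nonstd_def)

lemma lead_exp_ideal: "lead_exp r ` (I - {0}) = nonstd"
proof
  show "lead_exp r ` (I - {0}) \<subseteq> nonstd" using lead_exp_nonstd by blast
  show "nonstd \<subseteq> lead_exp r ` (I - {0})"
  proof
    fix \<alpha> assume "\<alpha> \<in> nonstd"
    then have "binom \<alpha> \<in> I - {0}" "\<alpha> = lead_exp r (binom \<alpha>)"
      using binom_in_ideal binom_nonzero lead_exp_binom by (auto simp: nonstd_def)
    then show "\<alpha> \<in> lead_exp r ` (I - {0})" by blast
  qed
qed

text \<open>The minimal generators, with respect to divisibility, of the monomial ideal
  \<open>nonstd\<close>.\<close>

definition corners :: "mon set" where
  "corners = {\<alpha> \<in> nonstd. \<forall>\<beta>\<in>nonstd. \<alpha> \<in> cone {0..k} \<beta> \<longrightarrow> \<beta> = \<alpha>}"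

text \<open>A nonstandard divisor of least degree is minimal, because all variables have positive
  degree and so a proper divisor has smaller degree.\<close>

lemma corner_below:
  assumes "\<alpha> \<in> nonstd"
  obtains \<beta> where "\<beta> \<in> corners" "\<alpha> \<in> cone {0..k} \<beta>"
proof -
  define P where "P \<beta> \<longleftrightarrow> \<beta> \<in> nonstd \<and> \<alpha> \<in> cone {0..k} \<beta>" for \<beta>
  obtain \<beta> where be: "P \<beta>" "\<And>\<gamma>. P \<gamma> \<Longrightarrow> D \<beta> \<le> D \<gamma>"
    using ex_has_least_nat[of P \<alpha> D] assms by (auto simp: P_def)
  have "\<gamma> = \<beta>" if g: "\<gamma> \<in> nonstd" "\<beta> \<in> cone {0..k} \<gamma>" for \<gamma>
  proof -
    obtain \<delta> where d: "\<delta> \<in> M" "\<beta> = \<gamma> + \<delta>" using g by (auto simp: cone_def)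
    have "P \<gamma>" using be(1) g cone_trans unfolding P_def by blast
    then have "D \<delta> = 0" using be(2)[of \<gamma>] d by (simp add: mon_degree_add)
    then show ?thesis using mon_degree_eq_0 generators_nonzero d by simp
  qed
  then show thesis using that be by (auto simp: P_def corners_def)
qed

lemma cone_corners: "(\<Union>\<alpha>\<in>corners. cone {0..k} \<alpha>) = nonstd"
proof
  show "(\<Union>\<alpha>\<in>corners. cone {0..k} \<alpha>) \<subseteq> nonstd" using cone_nonstd unfolding corners_def by blast
  show "nonstd \<subseteq> (\<Union>\<alpha>\<in>corners. cone {0..k} \<alpha>)" using corner_below by blast
qed

text \<open>A corner lies in the cone of some leading exponent and equals it by minimality.
  Conversely, a leading exponent lies above a corner, which is itself the leading exponent of some
  \<open>h\<close>; reducedness then forces \<open>h = g\<close>.\<close>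

lemma lead_exp_reduced_basis:
  assumes "is_reduced_groebner_basis {0..k} r I G"
  shows "lead_exp r ` G = corners"
proof -
  have G: "G \<subseteq> I - {0}" "(\<Union>g\<in>G. cone {0..k} (lead_exp r g)) = nonstd"
    "\<And>g h. g \<in> G \<Longrightarrow> h \<in> G \<Longrightarrow> h \<noteq> g \<Longrightarrow> keys g \<inter> cone {0..k} (lead_exp r h) = {}"
    using assms lead_exp_ideal by (auto simp: is_reduced_groebner_basis_def)
  have sup: "corners \<subseteq> lead_exp r ` G"
  proof
    fix \<alpha> assume al: "\<alpha> \<in> corners"
    then have "\<alpha> \<in> (\<Union>g\<in>G. cone {0..k} (lead_exp r g))" using G by (auto simp: corners_def)
    then obtain g where g: "g \<in> G" "\<alpha> \<in> cone {0..k} (lead_exp r g)" by blast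
    moreover from this have "lead_exp r g \<in> nonstd" using G(1) lead_exp_nonstd by blast
    ultimately have "lead_exp r g = \<alpha>" using al by (simp add: corners_def)
    then show "\<alpha> \<in> lead_exp r ` G" using g by blast
  qed
  moreover have "lead_exp r g \<in> corners" if g: "g \<in> G" for g
  proof -
    have "lead_exp r g \<in> nonstd" using g G lead_exp_nonstd by blast
    then obtain \<beta> where be: "\<beta> \<in> corners" "lead_exp r g \<in> cone {0..k} \<beta>"
      using corner_below by blast
    then obtain h where h: "h \<in> G" "\<beta> = lead_exp r h" using sup by blast
    moreover have "lead_exp r g \<in> keys g"
      using g G(1) monoid_ideal_polys by (intro lead_exp_greatest) blast+
    ultimately have "h = g" using G(3)[OF g h(1)] be by blast
    then show ?thesis using h be by simp
  qed
  ultimately show ?thesis by blast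
qed

text \<open>An element of a reduced basis and the binomial with the same leading exponent differ by
  an element of the ideal with standard monomials only, hence by zero.\<close>

lemma reduced_basis_unique:
  assumes G: "is_reduced_groebner_basis {0..k} r I G"
  shows "G = binom ` corners"
proof -
  have G': "G \<subseteq> I - {0}" "(\<Union>g\<in>G. cone {0..k} (lead_exp r g)) = nonstd"
    "\<And>g h. g \<in> G \<Longrightarrow> h \<in> G \<Longrightarrow> h \<noteq> g \<Longrightarrow> keys g \<inter> cone {0..k} (lead_exp r h) = {}"
    "\<And>g. g \<in> G \<Longrightarrow> lookup g (lead_exp r g) = 1"
    using assms lead_exp_ideal by (auto simp: is_reduced_groebner_basis_def)
  have "g = binom (lead_exp r g)" if g: "g \<in> G" for g
  proof -
    let ?l = "lead_exp r g"
    have l: "?l \<in> nonstd" using g lead_exp_nonstd G' by blast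
    have poly: "g \<in> polys {0..k}" "g \<noteq> 0" using g G'(1) monoid_ideal_polys by blast+
    \<comment> \<open>Reducedness leaves only the cone of \<open>g\<close> itself for a nonstandard
      tail monomial, but multiples of the leading monomial cannot be smaller than it.\<close>
    have tail: "\<beta> \<notin> nonstd" if b: "\<beta> \<in> keys g" "\<beta> \<noteq> ?l" for \<beta>
    proof
      assume "\<beta> \<in> nonstd"
      then obtain h where h: "h \<in> G" "\<beta> \<in> cone {0..k} (lead_exp r h)" using G' by blast
      then have "h = g" using G'(3)[OF g, of h] b by blast
      then obtain \<gamma> where "\<gamma> \<in> M" "\<beta> = ?l + \<gamma>" using h by (auto simp: cone_def)
      moreover from this have "(?l, \<beta>) \<in> r"
        using order_add[OF zero_least, of \<gamma> ?l] l by (simp add: nonstd_def add.commute)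
      ultimately show False
        using lead_exp_greatest(2)[OF poly b(1)] order_antisym b by blast
    qed
    have "\<beta> \<notin> nonstd" if "\<beta> \<in> keys (g - binom ?l)" for \<beta>
    proof (cases "\<beta> = ?l")
      case True
      then show ?thesis using that l G'(4)[OF g] by (simp add: in_keys_iff lookup_minus lookup_binom_lead)
    next
      case False
      then show ?thesis using that tail l keys_minus_subset[of g "binom ?l"] by (auto simp: keys_binom)
    qed
    moreover have "g - binom ?l \<in> I"
      using g G' l binom_in_ideal by (intro monoid_ideal_diff) (auto simp: nonstd_def)
    ultimately have "g - binom ?l = 0" by (intro ideal_std_eq_0) auto
    then show ?thesis by simp
  qed
  then have "G = (\<lambda>g. binom (lead_exp r g)) ` G" by force
  then show ?thesis using lead_exp_reduced_basis[OF G] by (metis image_image)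
qed

text \<open>Of the two monomials of a binomial, the standard one lies in no cone over a nonstandard
  monomial, and the corner lies in no cone over another corner.\<close>

lemma reduced_basis_exists:
  assumes "finite corners"
  shows "is_reduced_groebner_basis {0..k} r I (binom ` corners)"
proof -
  have c: "\<alpha> \<in> nonstd" "\<alpha> \<in> M" if "\<alpha> \<in> corners" for \<alpha>
    using that by (auto simp: corners_def nonstd_def)
  have binom_disjoint: "keys (binom \<alpha>) \<inter> cone {0..k} \<beta> = {}"
    if "\<alpha> \<in> corners" "\<beta> \<in> corners" "\<beta> \<noteq> \<alpha>" for \<alpha> \<beta>
  proof -
    have "std (D \<alpha>) \<notin> cone {0..k} \<beta>" using that c cone_nonstd std_notin_nonstd by blast
    moreover have "\<alpha> \<notin> cone {0..k} \<beta>" using that c unfolding corners_def by blast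
    ultimately show ?thesis using that(1) c by (simp add: keys_binom)
  qed
  have disjoint: "keys g \<inter> cone {0..k} (lead_exp r h) = {}"
    if gh: "g \<in> binom ` corners" "h \<in> binom ` corners - {g}" for g h
  proof -
    obtain \<alpha> \<beta> where "\<alpha> \<in> corners" "g = binom \<alpha>" "\<beta> \<in> corners" "h = binom \<beta>" "\<beta> \<noteq> \<alpha>"
      using gh by blast
    with binom_disjoint[of \<alpha> \<beta>] show ?thesis using c by (simp add: lead_exp_binom)
  qed
  have "(\<Union>g\<in>binom ` corners. cone {0..k} (lead_exp r g)) = nonstd"
    using c lead_exp_binom cone_corners by simp
  with disjoint show ?thesis
    unfolding is_reduced_groebner_basis_def lead_exp_ideal
    using assms c binom_in_ideal binom_nonzero
    by (intro conjI ballI) (auto simp: lead_exp_binom lookup_binom_lead)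
qed

lemma monoid_basis_eq:
  assumes "finite corners"
  shows "monoid_basis k a r = binom ` corners"
  unfolding monoid_basis_def reduced_groebner_basis_def
  using reduced_basis_exists[OF assms] reduced_basis_unique by (rule the_equality)

lemma E_set_eq:
  assumes "finite corners"
  shows "E_set k a r = nonstd"
  using cone_corners lead_exp_binom by (auto simp: E_set_def monoid_basis_eq[OF assms] corners_def)

section \<open>Normal forms of monomials\<close>

text \<open>While a monomial is nonstandard, a basis binomial rewrites it to a smaller monomial of
  the same degree; well-foundedness of the ordering ends this.\<close>

lemma reduces_monom_std:
  assumes "\<alpha> \<in> M"
  shows "(reduces {0..k} r (binom ` corners))\<^sup>*\<^sup>* (monom \<alpha> 1) (monom (std (D \<alpha>)) 1)"
  using order_facts(6) assms
proof (induction \<alpha> rule: wf_induct_rule)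
  case (less \<alpha>)
  show ?case
  proof (cases "\<alpha> \<in> nonstd")
    case True
    then obtain \<beta> where be: "\<beta> \<in> corners" "\<alpha> \<in> cone {0..k} \<beta>" using corner_below by blast
    then obtain \<delta> where d: "\<delta> \<in> M" "\<alpha> = \<delta> + \<beta>" by (auto simp: cone_def add.commute)
    have ns: "\<beta> \<in> nonstd" using be by (simp add: corners_def)
    \<comment> \<open>The corner \<open>\<beta>\<close> dividing \<open>\<alpha>\<close> is
      exchanged for the standard monomial of its degree.\<close>
    define \<gamma> where "\<gamma> = \<delta> + std (D \<beta>)"
    have "(std (D \<beta>) + \<delta>, \<beta> + \<delta>) \<in> r"
      using ns d std by (intro order_add) (auto simp: nonstd_def)
    moreover have "\<gamma> \<noteq> \<alpha>" using ns by (simp add: d \<gamma>_def nonstd_def)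
    ultimately have "(\<gamma>, \<alpha>) \<in> r - Id" by (simp add: d \<gamma>_def add.commute)
    then have "(reduces {0..k} r (binom ` corners))\<^sup>*\<^sup>* (monom \<gamma> 1) (monom (std (D \<gamma>)) 1)"
      using d std by (intro less.IH) (auto simp: \<gamma>_def)
    moreover have "D \<gamma> = D \<alpha>" by (simp add: \<gamma>_def d mon_degree_add std)
    moreover have "monom \<gamma> 1 = monom \<alpha> 1 - monom \<delta> 1 * binom \<beta>"
      by (simp add: binom_def right_diff_distrib mult_single d \<gamma>_def)
    then have "reduces {0..k} r (binom ` corners) (monom \<alpha> 1) (monom \<gamma> 1)"
      unfolding reduces_def using d be ns
      by (intro bexI[of _ "binom \<beta>"] bexI[of _ \<delta>])
        (simp_all add: lead_exp_binom lookup_binom_lead)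
    ultimately show ?thesis by (simp add: converse_rtranclp_into_rtranclp)
  next
    case False
    then show ?thesis using less.prems by (simp add: nonstd_def)
  qed
qed

lemma reduces_in_ideal:
  assumes "(reduces {0..k} r (binom ` corners))\<^sup>*\<^sup>* f h"
  shows "f - h \<in> I"
  using assms
proof (induction rule: rtranclp_induct)
  case base
  show ?case using monoid_ideal_zero by simp
next
  case (step g h)
  then obtain \<beta> \<delta> c where "\<beta> \<in> corners" "\<delta> \<in> M" "h = g - monom \<delta> c * binom \<beta>"
    unfolding reduces_def by blast
  then have "g - h \<in> I"
    using binom_in_ideal monoid_ideal_mult by (simp add: corners_def nonstd_def)
  then show ?case using monoid_ideal_add[OF step.IH, of "g - h"] by simp
qed

text \<open>The cones over the corners fill \<open>nonstd\<close>, so a term is divisible by a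
  leading exponent exactly when it is nonstandard.\<close>

lemma irreducible_iff:
  "(\<nexists>h. reduces {0..k} r (binom ` corners) f h) \<longleftrightarrow> keys f \<inter> nonstd = {}"
proof -
  have "(\<exists>h. reduces {0..k} r (binom ` corners) f h)
      \<longleftrightarrow> (\<exists>\<beta>\<in>corners. \<exists>\<delta>\<in>M. \<beta> + \<delta> \<in> keys f)"
    by (auto simp: reduces_def lead_exp_binom corners_def add.commute)
  also have "\<dots> \<longleftrightarrow> keys f \<inter> (\<Union>\<beta>\<in>corners. cone {0..k} \<beta>) \<noteq> {}"
    by (auto simp: cone_def)
  finally show ?thesis by (simp add: cone_corners)
qed

lemma normal_form_x_power:
  assumes "finite corners"
  shows "normal_form {0..k} r (monoid_basis k a r) (var 0 ^ N) = monom (std N) 1"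
  unfolding normal_form_def monoid_basis_eq[OF assms] irreducible_iff
proof (rule the_equality)
  let ?R = "(reduces {0..k} r (binom ` corners))\<^sup>*\<^sup>*"
  have red: "?R (var 0 ^ N) (monom (std N) 1)"
    using reduces_monom_std[of "Poly_Mapping.single 0 N"] by (simp add: var_power)
  then show "?R (var 0 ^ N) (monom (std N) 1) \<and> keys (monom (std N) 1) \<inter> nonstd = {}" by simp
  fix h assume h: "?R (var 0 ^ N) h \<and> keys h \<inter> nonstd = {}"
  \<comment> \<open>Both results of the division are congruent to x^N modulo the ideal.\<close>
  have "h - monom (std N) 1 \<in> I"
    using monoid_ideal_diff[OF reduces_in_ideal[OF red] reduces_in_ideal] h by fastforce
  moreover have "keys (h - monom (std N) 1) \<inter> nonstd = {}"
    using h keys_minus_subset[of h "monom (std N) 1"] by auto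
  ultimately have "h - monom (std N) 1 = 0" by (rule ideal_std_eq_0)
  then show "h = monom (std N) 1" by simp
qed

lemma lead_exp_normal_form:
  "finite corners \<Longrightarrow>
    lead_exp r (normal_form {0..k} r (monoid_basis k a r) (var 0 ^ N)) = std N"
  by (simp add: normal_form_x_power lead_exp_monom std)

end

section \<open>Apery sets\<close>

lemma gen_monoid_iff:
  "N \<in> gen_monoid k a \<longleftrightarrow> (\<exists>\<alpha>\<in>mons {0..k}. lookup \<alpha> 0 = 0 \<and> mon_degree k a \<alpha> = N)"
proof
  assume "N \<in> gen_monoid k a"
  then obtain c where c: "N = (\<Sum>i=1..k. c i * a i)" by (auto simp: gen_monoid_def)
  define \<alpha> where "\<alpha> = (\<Sum>i=1..k. Poly_Mapping.single i (c i))"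
  have "lookup \<alpha> i = (if i \<in> {1..k} then c i else 0)" for i
    by (simp add: \<alpha>_def lookup_sum lookup_single when_def)
  then have "\<alpha> \<in> mons {0..k}" "lookup \<alpha> 0 = 0" "mon_degree k a \<alpha> = N"
    by (auto simp: c mons_def in_keys_iff mon_degree_def split: if_splits)
  then show "\<exists>\<alpha>\<in>mons {0..k}. lookup \<alpha> 0 = 0 \<and> mon_degree k a \<alpha> = N" by blast
next
  assume "\<exists>\<alpha>\<in>mons {0..k}. lookup \<alpha> 0 = 0 \<and> mon_degree k a \<alpha> = N"
  then show "N \<in> gen_monoid k a" by (auto simp: gen_monoid_def mon_degree_def)
qed

lemma zero_in_gen_monoid: "0 \<in> gen_monoid k a"
  unfolding gen_monoid_iff by (intro bexI[of _ 0]) auto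

lemma gen_monoid_add_generator:
  assumes "x \<in> gen_monoid k a" "i \<in> {1..k}"
  shows "x + n * a i \<in> gen_monoid k a"
proof -
  obtain \<alpha> where "\<alpha> \<in> mons {0..k}" "lookup \<alpha> 0 = 0" "mon_degree k a \<alpha> = x"
    using assms by (auto simp: gen_monoid_iff)
  then show ?thesis
    unfolding gen_monoid_iff using assms(2)
    by (intro bexI[of _ "\<alpha> + Poly_Mapping.single i n"])
      (auto simp: lookup_add lookup_single mon_degree_add mon_degree_single)
qed

text \<open>Bezout's identity for \<open>a (Suc n)\<close> and the gcd of the earlier generators;
  the earlier coefficients are multiplied by \<open>v\<close>.\<close>

lemma Gcd_bezout:
  fixes a :: "nat \<Rightarrow> nat"
  shows "\<exists>c :: nat \<Rightarrow> int. (\<Sum>i=1..n. c i * int (a i)) = int (Gcd (a ` {1..n}))"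
proof (induction n)
  case (Suc n)
  then obtain c :: "nat \<Rightarrow> int" where c: "(\<Sum>i=1..n. c i * int (a i)) = int (Gcd (a ` {1..n}))" ..
  obtain u v where uv: "u * int (a (Suc n)) + v * int (Gcd (a ` {1..n}))
      = gcd (int (a (Suc n))) (int (Gcd (a ` {1..n})))"
    using bezout_int by blast
  define c' where "c' i = (if i = Suc n then u else v * c i)" for i
  have "(\<Sum>i=1..Suc n. c' i * int (a i)) = (\<Sum>i=1..n. v * (c i * int (a i))) + u * int (a (Suc n))"
    by (simp add: c'_def mult.assoc)
  also have "\<dots> = v * int (Gcd (a ` {1..n})) + u * int (a (Suc n))"
    by (simp only: c flip: sum_distrib_left)
  also have "\<dots> = int (gcd (a (Suc n)) (Gcd (a ` {1..n})))"
    using uv by (simp add: add.commute)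
  also have "\<dots> = int (Gcd (a ` {1..Suc n}))"
    by (simp add: atLeastAtMostSuc_conv)
  finally show ?case by blast
qed simp

text \<open>The gcd condition makes the monoid meet every residue class, so that the minima defining
  the Apery set exist.\<close>

lemma gen_monoid_residue:
  assumes "numerical_generators k a" "s \<noteq> 0"
  shows "\<exists>w\<in>gen_monoid k a. w mod s = i mod s"
proof -
  obtain c where "(\<Sum>j=1..k. c j * int (a j)) = int (Gcd (a ` {1..k}))"
    using Gcd_bezout by blast
  then have c: "(\<Sum>j=1..k. c j * int (a j)) = 1"
    using assms(1) by (simp add: numerical_generators_def)
  \<comment> \<open>Nonnegative representatives modulo \<open>s\<close> of the Bezout coefficients
    scaled by \<open>i\<close>.\<close>
  define d where "d j = nat (c j * int i mod int s)" for j
  define w where "w = (\<Sum>j=1..k. d j * a j)"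
  have d: "int (d j) = c j * int i mod int s" for j
    using assms(2) by (simp add: d_def)
  have "int w mod int s = (\<Sum>j=1..k. (c j * int i mod int s) * int (a j)) mod int s"
    by (simp add: w_def d)
  also have "\<dots> = (\<Sum>j=1..k. (c j * int i mod int s) * int (a j) mod int s) mod int s"
    by (rule mod_sum_eq[symmetric])
  also have "\<dots> = (\<Sum>j=1..k. (c j * int i) * int (a j) mod int s) mod int s"
    by (simp add: mod_mult_left_eq)
  also have "\<dots> = (\<Sum>j=1..k. (c j * int i) * int (a j)) mod int s"
    by (rule mod_sum_eq)
  also have "(\<Sum>j=1..k. (c j * int i) * int (a j)) = int i * (\<Sum>j=1..k. c j * int (a j))"
    by (simp add: sum_distrib_left mult_ac)
  finally have "w mod s = i mod s"
    unfolding c by (metis mult.right_neutral of_nat_eq_iff of_nat_mod)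
  then show ?thesis by (auto simp: w_def gen_monoid_def)
qed

text \<open>The two descriptions agree: an element of the monoid is the least in its class modulo
  \<open>a k\<close> exactly when subtracting \<open>a k\<close> leaves the monoid.\<close>

lemma apery_set_iff:
  assumes "numerical_generators k a" "k \<ge> 1" "a k \<noteq> 0"
  shows "x \<in> apery_set (gen_monoid k a) (a k)
    \<longleftrightarrow> x \<in> gen_monoid k a \<and> (\<forall>y\<in>gen_monoid k a. y + a k \<noteq> x)"
proof -
  define S s where "S = gen_monoid k a" and "s = a k"
  define w where "w i = (LEAST w. w \<in> S \<and> w mod s = i)" for i
  have w: "w i \<in> S" "w i mod s = i" "\<And>x. x \<in> S \<Longrightarrow> x mod s = i \<Longrightarrow> w i \<le> x" if "i < s" for i
  proof -
    have "\<exists>x. x \<in> S \<and> x mod s = i"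
      using gen_monoid_residue[OF assms(1), of s i] that by (auto simp: S_def)
    from LeastI_ex[OF this] show "w i \<in> S" "w i mod s = i" by (auto simp: w_def)
    show "w i \<le> x" if "x \<in> S" "x mod s = i" for x
      using that unfolding w_def by (intro Least_le) auto
  qed
  \<comment> \<open>The separately inserted 0 is the minimum of its own class, so all residues can
    be treated alike.\<close>
  have "w 0 = 0"
    using w(3)[of 0 0] assms(3) by (simp add: S_def s_def zero_in_gen_monoid)
  moreover have "{0..<s} = insert 0 {1..<s}"
    using assms(3) by (auto simp: s_def)
  moreover have "apery_set S s = insert 0 (w ` {1..<s})"
    unfolding apery_set_def w_def ..
  ultimately have "apery_set S s = w ` {0..<s}" by simp
  moreover have "x \<in> w ` {0..<s} \<longleftrightarrow> x \<in> S \<and> (\<forall>y\<in>S. y + s \<noteq> x)"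
  proof
    assume "x \<in> w ` {0..<s}"
    then obtain i where i: "i < s" "x = w i" by auto
    have "y + s \<noteq> x" if "y \<in> S" for y
    proof
      assume "y + s = x"
      then have "y mod s = i" "y < x" using w(2)[OF i(1)] i by (metis mod_add_self2, linarith)
      then show False using w(3)[OF i(1) that] i by simp
    qed
    then show "x \<in> S \<and> (\<forall>y\<in>S. y + s \<noteq> x)" using w(1) i by blast
  next
    assume x: "x \<in> S \<and> (\<forall>y\<in>S. y + s \<noteq> x)"
    define i where "i = x mod s"
    have i: "i < s" using assms(3) by (simp add: i_def s_def)
    have "w i \<le> x" using w(3)[OF i] x by (simp add: i_def)
    moreover have "x mod s = w i mod s" using w(2)[OF i] by (simp add: i_def)
    ultimately have "s dvd x - w i" by (simp add: mod_eq_dvd_iff_nat)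
    then obtain t where t: "x = w i + s * t"
      using \<open>w i \<le> x\<close> by (metis dvdE le_add_diff_inverse)
    \<comment> \<open>Otherwise \<open>w i + (t - 1) * s\<close> is an element of \<open>S\<close>
      from which \<open>x\<close> arises by adding \<open>s\<close>.\<close>
    have "t = 0"
    proof (cases t)
      case (Suc u)
      have "w i + u * s \<in> S"
        using gen_monoid_add_generator w(1)[OF i] assms(2) by (simp add: S_def s_def)
      moreover have "w i + u * s + s = x" by (simp add: t Suc)
      ultimately show ?thesis using x by blast
    qed simp
    then show "x \<in> w ` {0..<s}" using t i by auto
  qed
  ultimately show ?thesis by (simp add: S_def s_def)
qed

text \<open>The condition for \<open>i = k\<close> is automatic: subtracting \<open>a k\<close> from
  \<open>N + a k\<close> gives \<open>N\<close>, which lies in the monoid.\<close>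

lemma type_set_iff:
  assumes "numerical_generators k a" "k \<ge> 1" "a k \<noteq> 0"
  shows "N \<in> type_set k a \<longleftrightarrow> N \<in> apery_set (gen_monoid k a) (a k) \<and>
    (\<forall>i\<in>{1..<k}. N + a i \<notin> apery_set (gen_monoid k a) (a k))"
proof -
  have "N + a k \<notin> apery_set (gen_monoid k a) (a k)" if "N \<in> apery_set (gen_monoid k a) (a k)"
    using that by (auto simp: apery_set_iff[OF assms])
  moreover have "{1..k} = insert k {1..<k}" using assms(2) by auto
  ultimately show ?thesis by (auto simp: type_set_def)
qed

section \<open>Extremal elements of an Apery ordering\<close>

locale apery_order =
  fixes k :: nat and a :: "nat \<Rightarrow> nat" and r :: "mon rel"
  assumes apery: "apery_ordering k a r"
    and generators_nonzero: "\<forall>i\<in>{1..k}. a i \<noteq> 0"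
    and k_pos: "k \<ge> 1"
    and numerical: "numerical_generators k a"
begin

sublocale graded_order k a r
  using apery generators_nonzero by unfold_locales (simp_all add: apery_ordering_def)

abbreviation Ap :: "nat set" where "Ap \<equiv> apery_set (gen_monoid k a) (a k)"

lemma apery_x: "\<alpha> \<in> M \<Longrightarrow> \<beta> \<in> M \<Longrightarrow> lookup \<alpha> 0 < lookup \<beta> 0 \<Longrightarrow> (\<alpha>, \<beta>) \<in> r - Id"
  using apery unfolding apery_ordering_def by fastforce

lemma apery_weight:
  "\<alpha> \<in> M \<Longrightarrow> \<beta> \<in> M \<Longrightarrow> lookup \<alpha> 0 = lookup \<beta> 0 \<Longrightarrow> y_weight k a \<alpha> < y_weight k a \<beta> \<Longrightarrow>
    (\<alpha>, \<beta>) \<in> r - Id"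
  using apery unfolding apery_ordering_def by fastforce

lemma Ap_iff: "x \<in> Ap \<longleftrightarrow> x \<in> gen_monoid k a \<and> (\<forall>y\<in>gen_monoid k a. y + a k \<noteq> x)"
  using numerical k_pos generators_nonzero by (intro apery_set_iff) auto

text \<open>\<open>x\<^bsup>a k\<^esup> \<succ> y\<^sub>k\<close> and \<open>y\<^sub>i\<^bsup>a k\<^esup> \<succ> y\<^sub>k\<^bsup>a i\<^esup>\<close> have equal degrees.\<close>

lemma power_nonstd:
  assumes "i < k"
  shows "Poly_Mapping.single i (a k) \<in> nonstd"
proof -
  have ak: "a k > 0" using generators_nonzero k_pos by simp
  show ?thesis
  proof (cases "i = 0")
    case True
    have "(Poly_Mapping.single k 1, Poly_Mapping.single 0 (a k)) \<in> r - Id"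
      using k_pos ak by (intro apery_x) (auto simp: lookup_single)
    then show ?thesis
      using k_pos True by (intro nonstdI[of "Poly_Mapping.single k 1"]) (auto simp: mon_degree_single)
  next
    case False
    have "a i > 0" using generators_nonzero False assms by auto
    then have "(Poly_Mapping.single k (a i), Poly_Mapping.single i (a k)) \<in> r - Id"
      using k_pos ak assms False
      by (intro apery_weight)
        (auto simp: lookup_single y_weight_def when_def if_distrib[of "\<lambda>x. x * _"] cong: if_cong)
    then show ?thesis
      using k_pos False assms
      by (intro nonstdI[of "Poly_Mapping.single k (a i)"]) (auto simp: mon_degree_single)
  qed
qed

text \<open>A larger exponent would make a nonstandard pure power a proper divisor of the
  corner.\<close>

lemma corner_bound:
  assumes "\<alpha> \<in> corners" "i < k"
  shows "lookup \<alpha> i \<le> a k"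
proof (rule ccontr)
  assume *: "\<not> lookup \<alpha> i \<le> a k"
  then have "\<alpha> \<in> cone {0..k} (Poly_Mapping.single i (a k))"
    using assms(1) by (intro le_imp_in_cone) (auto simp: corners_def nonstd_def lookup_single when_def)
  then have "Poly_Mapping.single i (a k) = \<alpha>"
    using power_nonstd[OF assms(2)] assms(1) by (simp add: corners_def)
  with * show False by auto
qed

text \<open>The exponents other than that of \<open>y\<^sub>k\<close> are bounded, and they determine a corner: of two
  corners that differ in the exponent of \<open>y\<^sub>k\<close> only, one divides the other.\<close>

lemma finite_corners: "finite corners"
proof (rule finite_imageD)
  define f where "f \<alpha> i = (if i = k then 0 else lookup \<alpha> i)" for \<alpha> :: mon and i
  have M: "\<alpha> \<in> M" if "\<alpha> \<in> corners" for \<alpha> using that by (simp add: corners_def nonstd_def)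
  have "f ` corners \<subseteq> {f. \<forall>i. (i \<in> {0..<k} \<longrightarrow> f i \<in> {..a k}) \<and> (i \<notin> {0..<k} \<longrightarrow> f i = 0)}"
    using corner_bound lookup_outside[OF M] by (force simp: f_def)
  then show "finite (f ` corners)"
    by (rule finite_subset) (rule finite_set_of_finite_funs; simp)
  have le: "\<alpha> = \<beta>" if c: "\<alpha> \<in> corners" "\<beta> \<in> corners" and f: "f \<alpha> = f \<beta>"
    and k: "lookup \<alpha> k \<le> lookup \<beta> k" for \<alpha> \<beta>
  proof -
    have "lookup \<alpha> i \<le> lookup \<beta> i" for i
      using k fun_cong[OF f, of i] by (cases "i = k") (auto simp: f_def)
    then have "\<beta> \<in> cone {0..k} \<alpha>" by (intro le_imp_in_cone M c)
    then show ?thesis using c by (simp add: corners_def)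
  qed
  show "inj_on f corners"
    by (rule inj_onI) (metis le nle_le)
qed

text \<open>Some monomial of degree \<open>N\<close> is free of x, hence so is the least one by
  criterion (1); a factor y_k would put N - a_k into the monoid.\<close>

lemma std_apery:
  assumes "N \<in> Ap"
  shows "lookup (std N) 0 = 0" "lookup (std N) k = 0"
proof -
  obtain \<beta> where be: "\<beta> \<in> M" "lookup \<beta> 0 = 0" "D \<beta> = N"
    using assms by (auto simp: Ap_iff gen_monoid_iff)
  show x: "lookup (std N) 0 = 0"
  proof (rule ccontr)
    assume "lookup (std N) 0 \<noteq> 0"
    then have "(\<beta>, std N) \<in> r - Id" using be std by (intro apery_x) auto
    then show False using std(3)[of \<beta> N] be order_antisym by blast
  qed
  show "lookup (std N) k = 0"
  proof (rule ccontr)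
    assume "lookup (std N) k \<noteq> 0"
    then obtain \<delta> where d: "\<delta> \<in> M" "std N = \<delta> + unit_mon k"
      using split_unit std(1) by metis
    then have "lookup \<delta> 0 = 0" using x by (simp add: lookup_add)
    then have "D \<delta> \<in> gen_monoid k a" using d gen_monoid_iff by blast
    moreover have "D \<delta> + a k = N"
      using std(2)[of N] d k_pos by (simp add: mon_degree_add mon_degree_unit)
    ultimately show False using assms by (auto simp: Ap_iff)
  qed
qed

text \<open>For i < k neither \<open>std N\<close> nor y_i involves x or y_k, so only
  nonstandardness can take the product out of the complement; for \<open>i = k\<close> the factor
  y_k does.\<close>

lemma extremal_iff:
  "N \<in> extremal_elements k a r \<longleftrightarrow> N \<in> Ap \<and> (\<forall>i\<in>{1..<k}. std N + unit_mon i \<in> nonstd)"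
proof -
  have "std N + unit_mon i \<notin> E_compl k a r \<inter> {\<alpha>. lookup \<alpha> 0 = 0 \<and> lookup \<alpha> k = 0}
      \<longleftrightarrow> i = k \<or> std N + unit_mon i \<in> nonstd" if "N \<in> Ap" "i \<in> {1..k}" for i
    using that std_apery[OF that(1)] std(1)[of N]
    by (auto simp: E_compl_def E_set_eq[OF finite_corners] lookup_add lookup_unit)
  then show ?thesis
    unfolding extremal_elements_def mem_Collect_eq lead_exp_normal_form[OF finite_corners]
    using atLeastAtMost_iff atLeastLessThan_iff le_neq_implies_less
    by (metis (no_types, lifting) less_imp_le_nat nat_less_le)
qed

text \<open>A representation of \<open>N + a i\<close> that uses \<open>y\<^sub>k\<close> has smaller weight than
  \<open>std N + unit_mon i\<close>, which does not.\<close>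

lemma type_set_extremal:
  assumes "N \<in> type_set k a"
  shows "N \<in> extremal_elements k a r"
  unfolding extremal_iff
proof (intro conjI ballI)
  have type: "N \<in> Ap" "\<And>i. i \<in> {1..<k} \<Longrightarrow> N + a i \<notin> Ap"
    using assms type_set_iff[OF numerical k_pos] generators_nonzero k_pos by auto
  show "N \<in> Ap" by fact
  fix i assume i: "i \<in> {1..<k}"
  have "N + a i \<in> gen_monoid k a"
    using gen_monoid_add_generator[of N k a i 1] type(1) i by (auto simp: Ap_iff)
  then obtain y where y: "y \<in> gen_monoid k a" "y + a k = N + a i"
    using type(2)[OF i] by (auto simp: Ap_iff)
  then obtain \<delta> where d: "\<delta> \<in> M" "lookup \<delta> 0 = 0" "D \<delta> = y"
    by (auto simp: gen_monoid_iff)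
  let ?\<alpha> = "std N + unit_mon i" and ?\<beta> = "\<delta> + unit_mon k"
  have D: "D ?\<alpha> = N + a i" "D ?\<beta> = N + a i"
    using i k_pos d y by (simp_all add: mon_degree_add mon_degree_unit std)
  have \<alpha>: "lookup ?\<alpha> 0 = 0" "lookup ?\<alpha> k = 0"
    using std_apery[OF type(1)] i by (auto simp: lookup_add lookup_unit)
  have \<beta>: "lookup ?\<beta> 0 = 0" "lookup ?\<beta> k > 0"
    using d k_pos by (auto simp: lookup_add lookup_unit)
  \<comment> \<open>Both monomials have the same degree and no x, and only \<open>?\<beta>\<close>
    spends part of the degree on y_k.\<close>
  have "y_weight k a ?\<beta> < y_weight k a ?\<alpha>"
    using mon_degree_y_weight[OF k_pos, of a ?\<alpha>] mon_degree_y_weight[OF k_pos, of a ?\<beta>]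
      D \<alpha> \<beta> generators_nonzero k_pos by simp
  then have "(?\<beta>, ?\<alpha>) \<in> r - Id"
    using \<alpha> \<beta> d std i by (intro apery_weight) auto
  then show "?\<alpha> \<in> nonstd" using D by (intro nonstdI[of ?\<beta>]) auto
qed

end

section \<open>An ordering that prefers a given variable\<close>

text \<open>The number of predecessors is a measure: transitivity carries those of \<open>x\<close>
  over to \<open>y\<close>, and \<open>x\<close> itself is a further one.\<close>

lemma wf_finite_predecessors:
  assumes "trans R" "irrefl R" "\<And>x. finite {y. (y, x) \<in> R}"
  shows "wf R"
proof (rule wf_subset)
  show "wf (measure (\<lambda>x. card {y. (y, x) \<in> R}))" by simp
  show "R \<subseteq> measure (\<lambda>x. card {y. (y, x) \<in> R})"
  proof clarsimp
    fix x y assume "(x, y) \<in> R"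
    then have "{z. (z, x) \<in> R} \<subset> {z. (z, y) \<in> R}"
      using assms(1,2) by (auto simp: irrefl_def dest: transD)
    then show "card {z. (z, x) \<in> R} < card {z. (z, y) \<in> R}"
      using assms(3) by (intro psubset_card_mono)
  qed
qed

text \<open>More factors y_i make a monomial smaller. Comparing weights first confines this reversal
  to the finitely many monomials of one weight, which saves well-foundedness; the last tie is broken
  by the linear order on exponent vectors.\<close>

definition prefer_order :: "nat \<Rightarrow> (nat \<Rightarrow> nat) \<Rightarrow> nat \<Rightarrow> mon rel" where
  "prefer_order k a i = {(\<alpha>, \<beta>). \<alpha> \<in> mons {1..<k} \<and> \<beta> \<in> mons {1..<k} \<and>
    (y_weight k a \<alpha> < y_weight k a \<beta> \<or> y_weight k a \<alpha> = y_weight k a \<beta> \<and>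
      (lookup \<beta> i < lookup \<alpha> i \<or> lookup \<alpha> i = lookup \<beta> i \<and> \<alpha> \<le> \<beta>))}"

text \<open>Since every a_i is at least 1, the weight bounds each exponent.\<close>

lemma finite_y_weight_le:
  assumes "\<forall>i\<in>{1..k}. a i \<noteq> 0"
  shows "finite {\<alpha> \<in> mons {1..<k}. y_weight k a \<alpha> \<le> n}"
proof (rule finite_subset)
  have "lookup \<alpha> i \<le> y_weight k a \<alpha>" if "i \<in> {1..<k}" for \<alpha> i
  proof -
    have "a i > 0" using that assms by simp
    then have "lookup \<alpha> i \<le> lookup \<alpha> i * a i" by simp
    also have "\<dots> \<le> y_weight k a \<alpha>"
      unfolding y_weight_def using that by (intro member_le_sum) auto
    finally show ?thesis .
  qed
  then show "{\<alpha> \<in> mons {1..<k}. y_weight k a \<alpha> \<le> n}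
      \<subseteq> {\<alpha> \<in> mons {1..<k}. \<forall>i\<in>{1..<k}. lookup \<alpha> i \<le> n}"
    using order_trans by fastforce
qed (rule finite_bounded_mons, simp)

lemma prefer_order_monomial_ordering:
  assumes "\<forall>i\<in>{1..k}. a i \<noteq> 0"
  shows "monomial_ordering {1..<k} (prefer_order k a i)"
proof -
  let ?q = "prefer_order k a i" and ?M = "mons {1..<k}"
  have "?q \<subseteq> ?M \<times> ?M" "refl_on ?M ?q" "antisym ?q" "total_on ?M ?q" and tr: "trans ?q"
    by (auto simp: prefer_order_def refl_on_def antisym_def total_on_def trans_def)
  moreover have "wf (?q - Id)"
  proof (rule wf_finite_predecessors)
    show "trans (?q - Id)" using tr \<open>antisym ?q\<close> by (rule trans_diff_Id)
    show "irrefl (?q - Id)" by (simp add: irrefl_def)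
    fix \<beta>
    have "{\<alpha>. (\<alpha>, \<beta>) \<in> ?q - Id} \<subseteq> {\<alpha> \<in> ?M. y_weight k a \<alpha> \<le> y_weight k a \<beta>}"
      by (auto simp: prefer_order_def)
    then show "finite {\<alpha>. (\<alpha>, \<beta>) \<in> ?q - Id}"
      using finite_y_weight_le[OF assms] finite_subset by blast
  qed
  moreover have "(\<alpha> + \<gamma>, \<beta> + \<gamma>) \<in> ?q" if "(\<alpha>, \<beta>) \<in> ?q" "\<gamma> \<in> ?M" for \<alpha> \<beta> \<gamma>
    using that by (auto simp: prefer_order_def y_weight_add lookup_add add_right_mono)
  ultimately show ?thesis
    by (auto simp: monomial_ordering_def well_order_on_def order_on_defs)
qed

section \<open>Apery orderings built from an ordering of y_1, ..., y_(k-1)\<close>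

definition apery_key :: "nat \<Rightarrow> (nat \<Rightarrow> nat) \<Rightarrow> mon \<Rightarrow> nat \<times> nat \<times> mon \<times> nat" where
  "apery_key k a \<alpha> = (lookup \<alpha> 0, y_weight k a \<alpha>, y_part k \<alpha>, lookup \<alpha> k)"

definition apery_extension :: "nat \<Rightarrow> (nat \<Rightarrow> nat) \<Rightarrow> mon rel \<Rightarrow> mon rel" where
  "apery_extension k a q = {(\<alpha>, \<beta>). \<alpha> \<in> mons {0..k} \<and> \<beta> \<in> mons {0..k} \<and> (\<alpha> = \<beta> \<or>
    (apery_key k a \<alpha>, apery_key k a \<beta>)
      \<in> less_than <*lex*> less_than <*lex*> (q - Id) <*lex*> less_than)}"

lemma apery_key_inj:
  assumes "\<alpha> \<in> mons {0..k}" "\<beta> \<in> mons {0..k}" "apery_key k a \<alpha> = apery_key k a \<beta>"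
  shows "\<alpha> = \<beta>"
proof (rule poly_mapping_eqI)
  fix i
  have eqs: "lookup (y_part k \<alpha>) i = lookup (y_part k \<beta>) i"
    "lookup \<alpha> 0 = lookup \<beta> 0" "lookup \<alpha> k = lookup \<beta> k"
    using assms(3) by (simp_all add: apery_key_def)
  consider "i = 0" | "i \<in> {1..<k}" | "i = k" | "i \<notin> {0..k}" by fastforce
  then show "lookup \<alpha> i = lookup \<beta> i"
    using assms(1,2) eqs by cases (simp_all add: lookup_y_part lookup_outside)
qed

text \<open>Order properties are pulled back along \<open>apery_key\<close> from the lexicographic
  product; totality also uses that the key is injective on monomials.\<close>

lemma apery_extension_ordering:
  assumes q: "monomial_ordering {1..<k} q"
  shows "apery_ordering k a (apery_extension k a q)"
proof -
  let ?r = "apery_extension k a q" and ?M = "mons {0..k}"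
  define L where "L = less_than <*lex*> less_than <*lex*> (q - Id) <*lex*> less_than"
  have q': "trans q" "antisym q" "total_on (mons {1..<k}) q" "wf (q - Id)"
    using q by (auto simp: monomial_ordering_def well_order_on_def order_on_defs)
  have r: "(\<alpha>, \<beta>) \<in> ?r \<longleftrightarrow>
      \<alpha> \<in> ?M \<and> \<beta> \<in> ?M \<and> (\<alpha> = \<beta> \<or> (apery_key k a \<alpha>, apery_key k a \<beta>) \<in> L)" for \<alpha> \<beta>
    by (simp add: apery_extension_def L_def)
  have wfL: "wf L" unfolding L_def using q'(4) by (intro wf_lex_prod wf_less_than)
  have transL: "trans L"
    unfolding L_def using trans_diff_Id[OF q'(1,2)] by (intro trans_lex_prod trans_less_than)
  have asym: "(y, x) \<notin> L" if "(x, y) \<in> L" for x y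
    using wfL that by (rule wf_asym)
  have totalL: "(apery_key k a \<alpha>, apery_key k a \<beta>) \<in> L \<or> (apery_key k a \<beta>, apery_key k a \<alpha>) \<in> L"
    if "\<alpha> \<in> ?M" "\<beta> \<in> ?M" "\<alpha> \<noteq> \<beta>" for \<alpha> \<beta>
  proof -
    have "apery_key k a \<alpha> \<noteq> apery_key k a \<beta>" using apery_key_inj that by blast
    \<comment> \<open>\<open>q\<close> is total only on monomials in y_1, ..., y_(k-1), hence the
      restriction on the third components.\<close>
    moreover have total: "(u, v) \<in> L \<or> (v, u) \<in> L"
      if "u \<noteq> v" "fst (snd (snd u)) \<in> mons {1..<k}" "fst (snd (snd v)) \<in> mons {1..<k}" for u v
      using that q'(3) by (cases u; cases v) (auto simp: L_def total_on_def)
    ultimately show ?thesis using y_part_in_mons[of k]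
      by (intro total) (simp_all add: apery_key_def)
  qed
  have addL: "(apery_key k a (\<alpha> + \<gamma>), apery_key k a (\<beta> + \<gamma>)) \<in> L"
    if "(apery_key k a \<alpha>, apery_key k a \<beta>) \<in> L" for \<alpha> \<beta> \<gamma>
  proof -
    have "(y_part k \<alpha> + y_part k \<gamma>, y_part k \<beta> + y_part k \<gamma>) \<in> q" if "(y_part k \<alpha>, y_part k \<beta>) \<in> q"
      using q that y_part_in_mons unfolding monomial_ordering_def by blast
    then show ?thesis
      using that by (auto simp: L_def apery_key_def y_part_add y_weight_add lookup_add)
  qed
  have "?r \<subseteq> ?M \<times> ?M" "refl_on ?M ?r" by (auto simp: r refl_on_def)
  moreover have "trans ?r" using transL unfolding trans_def r by metis
  moreover have "antisym ?r" using asym unfolding antisym_def r by metis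
  moreover have "total_on ?M ?r" using totalL by (auto simp: r total_on_def)
  moreover have "wf (?r - Id)"
  proof (rule wf_subset)
    show "wf (inv_image L (apery_key k a))" using wfL by (rule wf_inv_image)
    show "?r - Id \<subseteq> inv_image L (apery_key k a)" by (auto simp: r)
  qed
  moreover have "\<forall>\<alpha>\<in>?M. \<forall>\<beta>\<in>?M. \<forall>\<gamma>\<in>?M. (\<alpha>, \<beta>) \<in> ?r \<longrightarrow> (\<alpha> + \<gamma>, \<beta> + \<gamma>) \<in> ?r"
    using addL by (auto simp: r)
  ultimately have "monomial_ordering {0..k} ?r"
    by (simp add: monomial_ordering_def well_order_on_def order_on_defs)
  \<comment> \<open>Asymmetry of \<open>L\<close> rules out \<open>\<alpha> = \<beta>\<close>, so
    removing the diagonal leaves exactly the comparison by \<open>L\<close>.\<close>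
  moreover have "(\<alpha>, \<beta>) \<in> ?r - Id \<longleftrightarrow> (apery_key k a \<alpha>, apery_key k a \<beta>) \<in> L"
    if "\<alpha> \<in> ?M" "\<beta> \<in> ?M" for \<alpha> \<beta>
    using that asym unfolding r Diff_iff pair_in_Id_conv by metis
  ultimately show ?thesis
    unfolding apery_ordering_def using q by (auto simp: L_def apery_key_def)
qed

lemma extremal_prefer_order:
  assumes num: "numerical_generators k a" and a: "\<forall>i\<in>{1..k}. a i \<noteq> 0" and i: "i \<in> {1..<k}"
    and N: "N \<in> extremal_elements k a (apery_extension k a (prefer_order k a i))"
  shows "N + a i \<notin> apery_set (gen_monoid k a) (a k)"
proof
  let ?r = "apery_extension k a (prefer_order k a i)"
  interpret apery_order k a ?r
    using num a i apery_extension_ordering[OF prefer_order_monomial_ordering[OF a]]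
    by unfold_locales auto
  assume Ni: "N + a i \<in> Ap"
  have NA: "N \<in> Ap" and ext: "std N + unit_mon i \<in> nonstd"
    using N i by (auto simp: extremal_iff)
  let ?\<alpha> = "std N + unit_mon i" and ?\<mu> = "std (N + a i)"
  have D: "D ?\<alpha> = N + a i" "?\<alpha> \<in> M"
    using i by (simp_all add: mon_degree_add mon_degree_unit std)
  then have le: "(?\<mu>, ?\<alpha>) \<in> ?r" using std(3) by blast
  have zero: "lookup ?\<alpha> 0 = 0" "lookup ?\<alpha> k = 0" "lookup ?\<mu> 0 = 0" "lookup ?\<mu> k = 0"
    using std_apery[OF NA] std_apery[OF Ni] i by (auto simp: lookup_add lookup_unit)
  \<comment> \<open>Without x and y_k the weight is the whole degree, so only
    \<open>prefer_order\<close> can separate the two monomials.\<close>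
  then have "y_weight k a ?\<mu> = y_weight k a ?\<alpha>"
    using mon_degree_y_weight[OF k_pos, of a ?\<alpha>] mon_degree_y_weight[OF k_pos, of a ?\<mu>] D
    by (simp add: std)
  then have "?\<mu> = ?\<alpha> \<or> (y_part k ?\<mu>, y_part k ?\<alpha>) \<in> prefer_order k a i"
    using le zero by (auto simp: apery_extension_def apery_key_def)
  moreover have "y_weight k a (y_part k \<beta>) = y_weight k a \<beta>" for \<beta>
    by (simp add: y_weight_def lookup_y_part)
  ultimately have "lookup ?\<alpha> i \<le> lookup ?\<mu> i"
    using i \<open>y_weight k a ?\<mu> = y_weight k a ?\<alpha>\<close>
    by (auto simp: prefer_order_def lookup_y_part)
  then have "lookup ?\<mu> i \<noteq> 0" by (simp add: lookup_add lookup_unit)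
  then obtain \<delta> where d: "\<delta> \<in> M" "?\<mu> = \<delta> + unit_mon i"
    using split_unit std(1) by metis
  have "D \<delta> = N"
    using std(2)[of "N + a i"] d i by (simp add: mon_degree_add mon_degree_unit)
  \<comment> \<open>The cofactor \<open>\<delta>\<close> has degree \<open>N\<close>, so
    \<open>std N\<close> is at most \<open>\<delta>\<close>; multiplying by y_i gives the reverse of
    \<open>le\<close>.\<close>
  then have "(?\<alpha>, ?\<mu>) \<in> ?r"
    using order_add[of "std N" \<delta> "unit_mon i"] std(3) d i by simp
  then have "?\<alpha> = ?\<mu>" using le order_antisym by blast
  then show False using ext std_notin_nonstd by simp
qed

theorem theorem15:
  fixes k :: nat and a :: "nat \<Rightarrow> nat"
  assumes "numerical_generators k a"
    and "\<forall>i\<in>{1..k}. a i \<noteq> 0"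
  shows "(\<Inter>r\<in>{r. apery_ordering k a r}. extremal_elements k a r) = type_set k a"
proof -
  \<comment> \<open>The gcd of no generators is 0, not 1.\<close>
  have k: "k \<ge> 1"
    using assms(1) by (cases k) (auto simp: numerical_generators_def)
  have "N \<in> type_set k a" if N: "\<forall>r. apery_ordering k a r \<longrightarrow> N \<in> extremal_elements k a r" for N
  proof -
    \<comment> \<open>Stated for every \<open>i\<close>, so that membership in the Apery set follows
      even when \<open>k = 1\<close> and there is no y_i with i < k.\<close>
    have ext: "N \<in> extremal_elements k a (apery_extension k a (prefer_order k a i))" for i
      using N apery_extension_ordering prefer_order_monomial_ordering assms(2) by blast
    then have "N \<in> apery_set (gen_monoid k a) (a k)" by (simp add: extremal_elements_def)
    then show ?thesis
      using type_set_iff[OF assms(1) k] assms k ext extremal_prefer_order by auto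
  qed
  moreover have "N \<in> extremal_elements k a r" if "N \<in> type_set k a" "apery_ordering k a r" for N r
  proof -
    interpret apery_order k a r using assms that k by unfold_locales
    show ?thesis using that type_set_extremal by blast
  qed
  ultimately show ?thesis by blast
qed

end
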